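(* Let $q$ be a prime power, let $1\le k\le n$ be integers, and let $\mathcal{C}\subseteq\mathcal{G}_q(n,k)$ be a one-orbit cyclic subspace code. Then $\mathcal{C}$ is a full weight spectrum (FWS) code if and only if $\mathcal{C}=\mathrm{Orb}(S)$ for some $k$-dimensional $\mathbb{F}_q$-subspace $S$ of $\mathbb{F}_{q^n}$ of one of the following two forms: (1) $S=\langle 1,\lambda,\ldots,\lambda^{k-1}\rangle_{\mathbb{F}_q}$ for some $\lambda\in\mathbb{F}_{q^n}\setminus\mathbb{F}_q$, where $k\le \frac{[\mathbb{F}_q(\lambda):\mathbb{F}_q]+1}{2}$ if $[\mathbb{F}_q(\lambda):\mathbb{F}_q]<n$, and $k\le \frac n2$ if $[\mathbb{F}_q(\lambda):\mathbb{F}_q]=n$; (2) $S=\langle 1,\lambda,\ldots,\lambda^{l-1}\rangle_{\mathbb{F}_{q^2}}\oplus\lambda^l\mathbb{F}_q$ for some $\lambda\in\mathbb{F}_{q^n}\setminus\mathbb{F}_{q^2}$, where $k=2l+1$, $n$ is even and $l<\frac{[\mathbb{F}_{q^2}(\lambda):\mathbb{F}_{q^2}]}{2}$.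
   Context: $\mathcal{G}_q(n,k)$ is the set of all $k$-dimensional $\mathbb{F}_q$-subspaces of $\mathbb{F}_{q^n}$, with distance $d(U,V)=2k-2\dim_{\mathbb{F}_q}(U\cap V)$. For $S\in\mathcal{G}_q(n,k)$, $\mathrm{Orb}(S)=\{\alpha S:\alpha\in\mathbb{F}_{q^n}^*\}$; a code of this form is called a one-orbit cyclic subspace code. For $\mathcal{C}=\mathrm{Orb}(S)$ and $i\in\{1,\dots,k\}$ put $\omega_{2i}(\mathcal{C})=|\{\alpha S\in\mathrm{Orb}(S): d(S,\alpha S)=2i\}|$ (this does not depend on the choice of the representative $S$). $\mathcal{C}$ is a full weight spectrum (FWS) code if it has exactly $k$ distinct non-zero weights, i.e. $\omega_{2i}(\mathcal{C})>0$ for every $i\in\{1,\dots,k\}$. $\langle\cdot\rangle_{\mathbb{F}}$ denotes the $\mathbb{F}$-linear span. *)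

theory Defs
  imports Complex_Main "HOL-Algebra.Algebra" "HOL-Number_Theory.Prime_Powers"
begin

no_notation subset_mset (infix \<open><#\<close> 50)  \<comment> \<open>clashes with left cosets\<close>

text \<open>
  \<open>L\<close> plays the role of the field with \<open>q ^ n\<close> elements and \<open>K\<close> that of its subfield with
  \<open>q\<close> elements. A \<open>K\<close>-subspace of \<open>L\<close> is what HOL-Algebra calls a \<open>subalgebra\<close>.
\<close>

definition grassmannian :: "('a, 'b) ring_scheme \<Rightarrow> 'a set \<Rightarrow> nat \<Rightarrow> 'a set set"
  where "grassmannian L K k = {U. subalgebra K U L \<and> ring.dimension L k K U}"

text \<open>Only used for \<open>U, V\<close> in \<open>grassmannian L K k\<close>, where the subtraction does not truncate.\<close>

definition subspace_dist :: "('a, 'b) ring_scheme \<Rightarrow> 'a set \<Rightarrow> nat \<Rightarrow> 'a set \<Rightarrow> 'a set \<Rightarrow> nat"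
  where "subspace_dist L K k U V = 2 * k - 2 * ring.dim L K (U \<inter> V)"

definition Orb :: "('a, 'b) ring_scheme \<Rightarrow> 'a set \<Rightarrow> 'a set set"
  where "Orb L S = {\<alpha> <#\<^bsub>L\<^esub> S | \<alpha>. \<alpha> \<in> carrier L - {\<zero>\<^bsub>L\<^esub>}}"

definition one_orbit_code :: "('a, 'b) ring_scheme \<Rightarrow> 'a set \<Rightarrow> nat \<Rightarrow> 'a set set \<Rightarrow> bool"
  where "one_orbit_code L K k C \<longleftrightarrow> (\<exists>S \<in> grassmannian L K k. C = Orb L S)"

text \<open>
  \<open>weight_count L K k C i\<close> is the number of codewords at distance \<open>2 * i\<close> from a chosen
  representative of \<open>C\<close>; independence of the choice is \<open>weight_count_eq\<close> below.
\<close>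

definition weight_count ::
    "('a, 'b) ring_scheme \<Rightarrow> 'a set \<Rightarrow> nat \<Rightarrow> 'a set set \<Rightarrow> nat \<Rightarrow> nat"
  where "weight_count L K k C i =
    (let S = (SOME S. S \<in> grassmannian L K k \<and> C = Orb L S)
     in card {V \<in> Orb L S. subspace_dist L K k S V = 2 * i})"

definition FWS_code :: "('a, 'b) ring_scheme \<Rightarrow> 'a set \<Rightarrow> nat \<Rightarrow> 'a set set \<Rightarrow> bool"
  where "FWS_code L K k C \<longleftrightarrow> (\<forall>i \<in> {1..k}. weight_count L K k C i > 0)"

text \<open>The degree of \<open>F(x)\<close> over \<open>F\<close>.\<close>

definition adjoin_degree :: "('a, 'b) ring_scheme \<Rightarrow> 'a set \<Rightarrow> 'a \<Rightarrow> nat"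
  where "adjoin_degree L F x = ring.dim L F (generate_field L (insert x F))"

definition powers_below :: "('a, 'b) ring_scheme \<Rightarrow> 'a \<Rightarrow> nat \<Rightarrow> 'a list"
  where "powers_below L x m = map (\<lambda>i. x [^]\<^bsub>L\<^esub> i) [0..<m]"


context field
begin

lemma l_coset_mult:
  assumes "a \<in> carrier R" "b \<in> carrier R" "S \<subseteq> carrier R"
  shows "a <# (b <# S) = (a \<otimes> b) <# S"
  using assms m_assoc unfolding l_coset_def by (auto simp: subset_iff)

lemma l_coset_one: "S \<subseteq> carrier R \<Longrightarrow> \<one> <# S = S"
  unfolding l_coset_def by (auto simp: subset_iff)

lemma l_coset_in_carrier: "a \<in> carrier R \<Longrightarrow> S \<subseteq> carrier R \<Longrightarrow> a <# S \<subseteq> carrier R"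
  unfolding l_coset_def by auto

lemma l_coset_inv_cancel:
  assumes "a \<in> carrier R - {\<zero>}" "S \<subseteq> carrier R"
  shows "inv a <# (a <# S) = S" "a <# (inv a <# S) = S"
  using assms by (simp_all add: l_coset_mult l_coset_one field_Units)

lemma l_coset_Int:
  assumes "a \<in> carrier R - {\<zero>}" "U \<subseteq> carrier R" "V \<subseteq> carrier R"
  shows "a <# (U \<inter> V) = (a <# U) \<inter> (a <# V)"
proof -
  have "inj_on ((\<otimes>) a) (U \<union> V)"
  proof (rule inj_onI)
    fix x y assume "x \<in> U \<union> V" "y \<in> U \<union> V" "a \<otimes> x = a \<otimes> y"
    moreover from this have "x \<in> carrier R" "y \<in> carrier R" using assms by auto
    ultimately show "x = y" using assms(1) m_lcancel by auto
  qed
  moreover have "a <# A = (\<otimes>) a ` A" for A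
    unfolding l_coset_def by auto
  ultimately show ?thesis
    using inj_on_image_Int[of "(\<otimes>) a" "U \<union> V" U V] by simp
qed

lemma l_coset_mem_iff: "x \<in> a <# E \<longleftrightarrow> (\<exists>e\<in>E. x = a \<otimes> e)"
  unfolding l_coset_def by auto

lemma l_coset_line_extension:
  assumes "a \<in> carrier R" "K \<subseteq> carrier R" "v \<in> carrier R" "E \<subseteq> carrier R"
  shows "a <# line_extension K v E = line_extension K (a \<otimes> v) (a <# E)"
proof (rule Set.set_eqI)
  fix x
  have *: "a \<otimes> (c \<otimes> v \<oplus> e) = c \<otimes> (a \<otimes> v) \<oplus> a \<otimes> e" if "c \<in> K" "e \<in> E" for c e
  proof -
    have "c \<in> carrier R" "e \<in> carrier R" using that assms by auto
    then show ?thesis using assms by (simp add: r_distr m_lcomm)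
  qed
  have "x \<in> a <# line_extension K v E \<longleftrightarrow> (\<exists>c\<in>K. \<exists>e\<in>E. x = a \<otimes> (c \<otimes> v \<oplus> e))"
    using l_coset_mem_iff[of x a] line_extension_mem_iff[of _ K v E] by metis
  also have "\<dots> \<longleftrightarrow> (\<exists>c\<in>K. \<exists>e\<in>E. x = c \<otimes> (a \<otimes> v) \<oplus> a \<otimes> e)"
    using * by auto
  also have "\<dots> \<longleftrightarrow> x \<in> line_extension K (a \<otimes> v) (a <# E)"
    using l_coset_mem_iff[of _ a E] line_extension_mem_iff[of x K "a \<otimes> v" "a <# E"] by metis
  finally show "x \<in> a <# line_extension K v E \<longleftrightarrow> x \<in> line_extension K (a \<otimes> v) (a <# E)" .
qed

lemma dimension_l_coset:
  assumes "subfield K R" "a \<in> carrier R - {\<zero>}" "dimension n K E"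
  shows "dimension n K (a <# E)"
  using assms(3,1)
proof (induction n K E rule: dimension.induct)
  case (zero_dim K)
  have "a <# {\<zero>} = {\<zero>}" using assms(2) by (simp add: l_coset_def)
  then show ?case by simp
next
  case (Suc_dim v E n K)
  have E: "E \<subseteq> carrier R"
    using space_subgroup_props(1)[OF Suc_dim.prems Suc_dim.hyps(3)] .
  have "a \<otimes> v \<notin> a <# E"
  proof
    assume "a \<otimes> v \<in> a <# E"
    then obtain e where "e \<in> E" "a \<otimes> v = a \<otimes> e" unfolding l_coset_def by auto
    then have "v = e" using assms(2) E Suc_dim.hyps(1) m_lcancel[of a v e] by auto
    then show False using \<open>e \<in> E\<close> Suc_dim.hyps(2) by simp
  qed
  moreover have "a \<otimes> v \<in> carrier R" using assms(2) Suc_dim.hyps(1) by simp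
  moreover have "a <# line_extension K v E = line_extension K (a \<otimes> v) (a <# E)"
    using l_coset_line_extension[of a K v E] assms(2) Suc_dim.hyps(1) E
      subfieldE(3)[OF Suc_dim.prems] by simp
  ultimately show ?case
    using dimension.Suc_dim Suc_dim.IH[OF Suc_dim.prems] by simp
qed

lemma dim_l_coset:
  assumes "subfield K R" "a \<in> carrier R - {\<zero>}" "U \<subseteq> carrier R"
  shows "dim K (a <# U) = dim K U"
proof -
  have "inv a \<in> carrier R - {\<zero>}"
    using assms(2) field_Units by (metis Units_inv_Units)
  then have "dimension n K (a <# U) \<longleftrightarrow> dimension n K U" for n
    using dimension_l_coset[OF assms(1)] assms(2,3) l_coset_inv_cancel(1) by metis
  then show ?thesis by (simp add: dim_def)
qed

lemma grassmannian_in_carrier: "U \<in> grassmannian R K k \<Longrightarrow> U \<subseteq> carrier R"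
  unfolding grassmannian_def using subalgebra_in_carrier by blast

lemma Orb_closed:
  assumes "a \<in> carrier R - {\<zero>}" "S \<subseteq> carrier R" "V \<in> Orb R S"
  shows "a <# V \<in> Orb R S" "V \<subseteq> carrier R"
proof -
  obtain b where b: "b \<in> carrier R - {\<zero>}" "V = b <# S"
    using assms(3) unfolding Orb_def by auto
  then have "a <# V = (a \<otimes> b) <# S" "a \<otimes> b \<in> carrier R - {\<zero>}"
    using assms(1,2) l_coset_mult integral[of a b] by auto
  then show "a <# V \<in> Orb R S" unfolding Orb_def by blast
  show "V \<subseteq> carrier R" using b assms(2) l_coset_in_carrier by simp
qed

lemma card_at_dist_eq:
  assumes K: "subfield K R" and S: "S \<subseteq> carrier R" "S' \<subseteq> carrier R"
    and eq: "Orb R S = Orb R S'"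
  shows "card {V \<in> Orb R S'. subspace_dist R K k S' V = j} =
         card {V \<in> Orb R S. subspace_dist R K k S V = j}"
proof -
  have "S' \<in> Orb R S'"
    unfolding Orb_def using l_coset_one[OF S(2)] one_not_zero by force
  then have "S' \<in> Orb R S" using eq by simp
  then obtain a where a: "a \<in> carrier R - {\<zero>}" "S' = a <# S"
    unfolding Orb_def by (elim CollectE exE conjE)
  have a': "inv a \<in> carrier R - {\<zero>}"
    using a(1) field_Units by (metis Units_inv_Units)
  have dist: "subspace_dist R K k S' (a <# V) = subspace_dist R K k S V" if "V \<in> Orb R S" for V
  proof -
    have "V \<subseteq> carrier R" using Orb_closed(2)[OF a(1) S(1) that] .
    then have "S' \<inter> (a <# V) = a <# (S \<inter> V)"
      using l_coset_Int[OF a(1) S(1)] a(2) by simp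
    moreover have "dim K (a <# (S \<inter> V)) = dim K (S \<inter> V)"
      using S(1) by (intro dim_l_coset[OF K a(1)]) auto
    ultimately show ?thesis by (simp add: subspace_dist_def)
  qed
  have "bij_betw ((<#) a) {V \<in> Orb R S. subspace_dist R K k S V = j}
                          {V \<in> Orb R S'. subspace_dist R K k S' V = j}"
  proof (rule bij_betw_byWitness[where f' = "(<#) (inv a)"])
    show "\<forall>V\<in>{V \<in> Orb R S. subspace_dist R K k S V = j}. inv a <# (a <# V) = V"
      using Orb_closed(2)[OF a(1) S(1)] l_coset_inv_cancel(1)[OF a(1)] by simp
    show "\<forall>V\<in>{V \<in> Orb R S'. subspace_dist R K k S' V = j}. a <# (inv a <# V) = V"
      using Orb_closed(2)[OF a(1) S(2)] l_coset_inv_cancel(2)[OF a(1)] by simp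
    show "(<#) a ` {V \<in> Orb R S. subspace_dist R K k S V = j}
            \<subseteq> {V \<in> Orb R S'. subspace_dist R K k S' V = j}"
    proof clarify
      fix V assume V: "V \<in> Orb R S"
      have "a <# V \<in> Orb R S'"
        using Orb_closed(1)[OF a(1) S(1) V] eq by simp
      then show "a <# V \<in> Orb R S' \<and>
          subspace_dist R K k S' (a <# V) = subspace_dist R K k S V"
        using dist[OF V] by simp
    qed
    show "(<#) (inv a) ` {V \<in> Orb R S'. subspace_dist R K k S' V = j}
            \<subseteq> {V \<in> Orb R S. subspace_dist R K k S V = j}"
    proof clarify
      fix V assume V: "V \<in> Orb R S'"
      have W: "inv a <# V \<in> Orb R S"
        using Orb_closed(1)[OF a' S(1)] V eq by simp
      have "a <# (inv a <# V) = V"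
        using Orb_closed(2)[OF a(1) S(2) V] l_coset_inv_cancel(2)[OF a(1)] by simp
      then show "inv a <# V \<in> Orb R S \<and>
          subspace_dist R K k S (inv a <# V) = subspace_dist R K k S' V"
        using W dist[OF W] by simp
    qed
  qed
  then show ?thesis by (simp add: bij_betw_same_card)
qed

lemma weight_count_eq:
  assumes "subfield K R" "S \<in> grassmannian R K k" "C = Orb R S"
  shows "weight_count R K k C i = card {V \<in> Orb R S. subspace_dist R K k S V = 2 * i}"
proof -
  define S' where "S' = (SOME S. S \<in> grassmannian R K k \<and> C = Orb R S)"
  have "S' \<in> grassmannian R K k \<and> C = Orb R S'"
    unfolding S'_def using assms(2,3) by (rule_tac someI) auto
  then show ?thesis
    using card_at_dist_eq[OF assms(1), of S S'] assms grassmannian_in_carrier[of S K k]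
      grassmannian_in_carrier[of S' K k]
    unfolding weight_count_def S'_def[symmetric] by (simp add: Let_def)
qed

end

end

theory Submission
  imports Defs
begin

text \<open>
  If a space \<open>S\<close> meets a translate \<open>x S\<close> in codimension one, then
  \<open>S = T \<oplus> y \<langle>1, x, \<dots>, x\<^sup>r\<^sup>-\<^sup>1\<rangle>\<close> with \<open>T\<close> stable under \<open>F(x)\<close> and \<open>r < d = [F(x) : F]\<close>. For \<open>T = 0\<close> this is
  form (1), and the existence of intersections of dimension 1 and 0 gives the bounds on \<open>k\<close>. For
  \<open>T \<noteq> 0\<close>, comparing \<open>T \<subseteq> S \<subseteq> T \<oplus> y F(x)\<close> with their translates confines \<open>dim (S \<inter> a S)\<close>
  modulo \<open>d\<close> to so few residues that all dimensions can occur only if \<open>d = 2\<close>. Then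
  \<open>S = T \<oplus> y F\<close> with \<open>T\<close> a space over \<open>H = F(x)\<close>. The intersections of odd dimension show that
  \<open>T \<oplus> y H\<close> attains all positive intersection dimensions over \<open>H\<close>, so the same dichotomy applies to
  it; here its first alternative must hold, so \<open>T \<oplus> y H\<close> and \<open>T\<close> are spanned over \<open>H\<close> by
  consecutive powers of a common element, which is form (2).
\<close>

section \<open>Subspaces of a finite field\<close>

text \<open>Put \<open>H = F(x)\<close> and \<open>V = T + y H\<close>. As \<open>V / T\<close> is a
  line over \<open>H\<close>, the \<open>H\<close>-space \<open>V \<inter> a V\<close> lies in
  \<open>T\<close> or meets it in codimension exactly d, and likewise for \<open>a T\<close>. Hence
  the few residues: only the relative position of two r-dimensional pieces of a line stays free.
  Counting residues still admits d = 3. There one attained dimension yields some \<open>a\<close>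
  outside \<open>H\<close> that stabilizes \<open>V\<close> or \<open>T\<close>, and the degree of
  this larger stabilizer would have to divide 3.

  The first alternative is forced over \<open>H\<close> as follows. Let \<open>m S\<close> meet
  \<open>S\<close> in codimension two, and let \<open>T'\<close> be the \<open>m\<close>-stable part
  of \<open>T + y H\<close>. If \<open>T'\<close> is nonzero, then \<open>H(m)\<close> is quadratic
  over \<open>H\<close>, and \<open>S \<inter> m S\<close> turns out to be \<open>m\<close>-stable
  with \<open>F\<close>-dimension one less than that of \<open>T'\<close>. So the degree of
  \<open>m\<close> over \<open>F\<close> divides two consecutive numbers, \<open>m\<close> lies in
  \<open>F\<close>, and \<open>m S = S\<close>, a contradiction.

  Odd dimensions over \<open>F\<close> give no information on translates meeting trivially over
  \<open>H\<close>; this is why the degree argument works with positive intersection dimensions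
  alone.\<close>

locale fin_field = field +
  assumes finite_carrier: "finite (carrier R)"
begin

text \<open>Negatives are multiples by the scalar \<open>\<ominus> \<one>\<close>, so being a
  subgroup reduces to containing zero and closure under sums.\<close>

lemma subalgebra_iff:
  assumes "subfield F R"
  shows "subalgebra F A R \<longleftrightarrow> A \<subseteq> carrier R \<and> \<zero> \<in> A \<and> (\<forall>a\<in>A. \<forall>b\<in>A. a \<oplus> b \<in> A) \<and>
           (\<forall>c\<in>F. \<forall>a\<in>A. c \<otimes> a \<in> A)"  (is "?L \<longleftrightarrow> ?R")
proof
  assume L: ?L
  then have sg: "subgroup A (add_monoid R)" by (rule subalgebra.axioms)
  show ?R
    using subgroup.subset[OF sg] subgroup.one_closed[OF sg] subgroup.m_closed[OF sg]
      subalgebra.smult_closed[OF L] by auto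
next
  assume A: ?R
  have m1: "\<ominus> \<one> \<in> F"
    using subringE(3,5)[OF subfieldE(1)[OF assms]] by simp
  have "\<ominus> a \<in> A" if "a \<in> A" for a
  proof -
    have "\<ominus> \<one> \<otimes> a \<in> A" using A m1 that by blast
    moreover have "a \<in> carrier R" using A that by blast
    ultimately show ?thesis by (simp add: l_minus)
  qed
  then have "subgroup A (add_monoid R)"
    using A by (intro add.subgroupI) auto
  then show ?L using A by (simp add: subalgebra_def subalgebra_axioms_def)
qed

lemma subalgebraI:
  assumes "subfield F R" "A \<subseteq> carrier R" "\<zero> \<in> A" "\<And>a b. a \<in> A \<Longrightarrow> b \<in> A \<Longrightarrow> a \<oplus> b \<in> A"
    "\<And>c a. c \<in> F \<Longrightarrow> a \<in> A \<Longrightarrow> c \<otimes> a \<in> A"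
  shows "subalgebra F A R"
  using assms by (simp add: subalgebra_iff)

lemma subalgebra_zero: "subalgebra F A R \<Longrightarrow> \<zero> \<in> A"
  using subgroup.one_closed[OF subalgebra.axioms(1)] by fastforce

lemma subalgebra_add: "subalgebra F A R \<Longrightarrow> a \<in> A \<Longrightarrow> b \<in> A \<Longrightarrow> a \<oplus> b \<in> A"
  using subgroup.m_closed[OF subalgebra.axioms(1)] by fastforce

lemma subalgebra_uminus: "subalgebra F A R \<Longrightarrow> a \<in> A \<Longrightarrow> \<ominus> a \<in> A"
  using subgroup.m_inv_closed[OF subalgebra.axioms(1)] by (fastforce simp: a_inv_def)

lemma subalgebra_minus: "subalgebra F A R \<Longrightarrow> a \<in> A \<Longrightarrow> b \<in> A \<Longrightarrow> a \<ominus> b \<in> A"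
  by (simp add: minus_eq subalgebra_add subalgebra_uminus)

lemma subalgebra_restrict: "subalgebra H A R \<Longrightarrow> F \<subseteq> H \<Longrightarrow> subalgebra F A R"
  by (auto simp: subalgebra_def subalgebra_axioms_def)

lemma subfield_subalgebra: "subfield F R \<Longrightarrow> F \<subseteq> H \<Longrightarrow> subfield H R \<Longrightarrow> subalgebra F H R"
  by (intro subalgebraI) (auto simp: subringE(2,6,7)[OF subfieldE(1)] dest: subfieldE(3))

lemma subalgebra_l_coset:
  assumes "subfield F R" "subalgebra F A R" "a \<in> carrier R"
  shows "subalgebra F (a <# A) R"
proof (rule subalgebraI[OF assms(1)])
  have A: "A \<subseteq> carrier R" using assms(2) subalgebra_in_carrier by blast
  show "a <# A \<subseteq> carrier R" using A assms(3) l_coset_in_carrier by simp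
  show "\<zero> \<in> a <# A"
    using subalgebra_zero[OF assms(2)] assms(3) by (force simp: l_coset_mem_iff)
  show "x \<oplus> y \<in> a <# A" if xy: "x \<in> a <# A" "y \<in> a <# A" for x y
  proof -
    obtain u v where "u \<in> A" "v \<in> A" "x = a \<otimes> u" "y = a \<otimes> v" using xy by (auto simp: l_coset_mem_iff)
    then have "x \<oplus> y = a \<otimes> (u \<oplus> v)" "u \<oplus> v \<in> A"
      using A assms(2,3) subalgebra_add by (auto simp: r_distr subset_iff)
    then show ?thesis by (auto simp: l_coset_mem_iff)
  qed
  show "c \<otimes> x \<in> a <# A" if cx: "c \<in> F" "x \<in> a <# A" for c x
  proof -
    obtain u where u: "u \<in> A" "x = a \<otimes> u" using cx by (auto simp: l_coset_mem_iff)
    have "c \<in> carrier R" "u \<in> carrier R" using cx u A subfieldE(3)[OF assms(1)] by auto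
    then have "c \<otimes> x = a \<otimes> (c \<otimes> u)" using u assms(3) by (simp add: m_lcomm)
    moreover have "c \<otimes> u \<in> A" using cx u subalgebra.smult_closed[OF assms(2)] by simp
    ultimately show ?thesis by (auto simp: l_coset_mem_iff)
  qed
qed

lemma l_coset_mono: "A \<subseteq> B \<Longrightarrow> a <# A \<subseteq> a <# B"
  by (auto simp: l_coset_def)

lemma set_add_mem_iff: "x \<in> A <+>\<^bsub>R\<^esub> B \<longleftrightarrow> (\<exists>a\<in>A. \<exists>b\<in>B. x = a \<oplus> b)"
  unfolding set_add_def' by auto

lemma set_add_subset:
  "subalgebra F C R \<Longrightarrow> A \<subseteq> C \<Longrightarrow> B \<subseteq> C \<Longrightarrow> A <+>\<^bsub>R\<^esub> B \<subseteq> C"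
  using subalgebra_add[of F C] by (fastforce simp: set_add_mem_iff)

lemma subset_set_add:
  assumes "subalgebra F A R" "subalgebra F B R"
  shows "A \<subseteq> A <+>\<^bsub>R\<^esub> B" "B \<subseteq> A <+>\<^bsub>R\<^esub> B"
proof -
  have c: "A \<subseteq> carrier R" "B \<subseteq> carrier R"
    using assms subalgebra_in_carrier by auto
  show "A \<subseteq> A <+>\<^bsub>R\<^esub> B"
    using subalgebra_zero[OF assms(2)] c(1) r_zero unfolding set_add_mem_iff subset_iff by metis
  show "B \<subseteq> A <+>\<^bsub>R\<^esub> B"
    using subalgebra_zero[OF assms(1)] c(2) l_zero unfolding set_add_mem_iff subset_iff by metis
qed

lemma subalgebra_set_add:
  assumes "subfield F R" "subalgebra F A R" "subalgebra F B R"
  shows "subalgebra F (A <+>\<^bsub>R\<^esub> B) R"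
proof (rule subalgebraI[OF assms(1)])
  have c: "A \<subseteq> carrier R" "B \<subseteq> carrier R" "F \<subseteq> carrier R"
    using assms subalgebra_in_carrier subfieldE(3) by auto
  show "A <+>\<^bsub>R\<^esub> B \<subseteq> carrier R" using c by (fastforce simp: set_add_mem_iff)
  show "\<zero> \<in> A <+>\<^bsub>R\<^esub> B" using subset_set_add[OF assms(2,3)] subalgebra_zero[OF assms(2)] by auto
  fix x assume "x \<in> A <+>\<^bsub>R\<^esub> B"
  then obtain a b where ab: "a \<in> A" "b \<in> B" "x = a \<oplus> b" by (auto simp: set_add_mem_iff)
  have abc: "a \<in> carrier R" "b \<in> carrier R" using ab c by auto
  { fix y assume "y \<in> A <+>\<^bsub>R\<^esub> B"
    then obtain a' b' where ab': "a' \<in> A" "b' \<in> B" "y = a' \<oplus> b'" by (auto simp: set_add_mem_iff)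
    have "a' \<in> carrier R" "b' \<in> carrier R" using ab' c by auto
    then have "x \<oplus> y = (a \<oplus> a') \<oplus> (b \<oplus> b')" using ab ab' abc by (simp add: a_ac)
    then show "x \<oplus> y \<in> A <+>\<^bsub>R\<^esub> B"
      using ab(1,2) ab'(1,2) subalgebra_add[OF assms(2)] subalgebra_add[OF assms(3)]
      unfolding set_add_mem_iff by blast }
  { fix c assume c': "c \<in> F"
    then have "c \<otimes> x = c \<otimes> a \<oplus> c \<otimes> b" using ab abc c by (auto simp: r_distr subset_iff)
    then show "c \<otimes> x \<in> A <+>\<^bsub>R\<^esub> B"
      using ab c' subalgebra.smult_closed assms(2,3) by (fastforce simp: set_add_mem_iff) }
qed

lemma l_coset_set_add:
  assumes "a \<in> carrier R" "A \<subseteq> carrier R" "B \<subseteq> carrier R"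
  shows "a <# (A <+>\<^bsub>R\<^esub> B) = (a <# A) <+>\<^bsub>R\<^esub> (a <# B)"
proof (rule Set.set_eqI)
  fix x
  have *: "a \<otimes> (u \<oplus> v) = a \<otimes> u \<oplus> a \<otimes> v" if "u \<in> A" "v \<in> B" for u v
    using that assms by (auto simp: r_distr subset_iff)
  have "x \<in> a <# (A <+>\<^bsub>R\<^esub> B) \<longleftrightarrow> (\<exists>u\<in>A. \<exists>v\<in>B. x = a \<otimes> (u \<oplus> v))"
    using set_add_mem_iff[of _ A B] unfolding l_coset_mem_iff by metis
  also have "\<dots> \<longleftrightarrow> (\<exists>u\<in>A. \<exists>v\<in>B. x = a \<otimes> u \<oplus> a \<otimes> v)"
    using * by (intro bex_cong refl) simp
  also have "\<dots> \<longleftrightarrow> x \<in> (a <# A) <+>\<^bsub>R\<^esub> (a <# B)"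
    using l_coset_mem_iff[of _ a] set_add_mem_iff[of x "a <# A" "a <# B"] by metis
  finally show "x \<in> a <# (A <+>\<^bsub>R\<^esub> B) \<longleftrightarrow> x \<in> (a <# A) <+>\<^bsub>R\<^esub> (a <# B)" .
qed

lemma set_add_mono: "A \<subseteq> A' \<Longrightarrow> B \<subseteq> B' \<Longrightarrow> A <+>\<^bsub>R\<^esub> B \<subseteq> A' <+>\<^bsub>R\<^esub> B'"
  unfolding set_add_def' by blast

lemma set_add_comm:
  assumes "A \<subseteq> carrier R" "B \<subseteq> carrier R"
  shows "A <+>\<^bsub>R\<^esub> B = B <+>\<^bsub>R\<^esub> A"
proof -
  have "U <+>\<^bsub>R\<^esub> V \<subseteq> V <+>\<^bsub>R\<^esub> U" if "U \<subseteq> carrier R" "V \<subseteq> carrier R" for U V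
    using that a_comm unfolding set_add_mem_iff subset_iff by metis
  then show ?thesis using assms by blast
qed

text \<open>A list of all elements of the finite carrier spans it, so \<open>dim\<close> is
  meaningful for every subspace.\<close>

lemma finite_dim:
  assumes "subfield F R" "subalgebra F A R"
  shows "finite_dimension F A"
proof -
  obtain us where us: "set us = carrier R" using finite_list[OF finite_carrier] by blast
  have "Span F us = carrier R"
    using Span_base_incl[OF assms(1), of us] Span_in_carrier[OF subfieldE(3)[OF assms(1)], of us] us
    by auto
  then have "finite_dimension F (carrier R)"
    using Span_finite_dimension[OF assms(1), of us] us by simp
  then show ?thesis
    using subalbegra_incl_imp_finite_dimension[OF assms(1) _ assms(2)]
      subalgebra_in_carrier[OF assms(2)] by blast
qed

lemma dimension_dim:
  assumes "subfield F R" "subalgebra F A R"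
  shows "dimension (dim F A) F A"
  using finite_dimensionE[OF assms(1) finite_dim[OF assms]] by (simp add: over_def)

lemma dim_eqI: "subfield F R \<Longrightarrow> dimension n F A \<Longrightarrow> dim F A = n"
  using dimI by (simp add: over_def)

lemma dim_set_add:
  assumes "subfield F R" "subalgebra F A R" "subalgebra F B R"
  shows "dim F (A <+>\<^bsub>R\<^esub> B) + dim F (A \<inter> B) = dim F A + dim F B"
proof -
  note d = dimension_dim[OF assms(1)]
  have sub: "subalgebra F (A \<inter> B) R" using assms subalgebra_inter by blast
  obtain Bs where Bs: "independent F Bs" "length Bs = dim F (A \<inter> B)" "Span F Bs = A \<inter> B"
    "set Bs \<subseteq> carrier R"
    using exists_base[OF assms(1) d[OF sub]] by auto
  then have "set Bs \<subseteq> A" using Span_base_incl[OF assms(1)] by blast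
  \<comment> \<open>The dimension supplied by \<open>dimension_sum_space\<close> is a natural-number
    difference; this bound keeps it from truncating.\<close>
  then have "dim F (A \<inter> B) \<le> dim F A"
    using independent_length_le_dimension[OF assms(1) d[OF assms(2)] Bs(1)] Bs(2) by simp
  then show ?thesis
    using dim_eqI[OF assms(1) dimension_sum_space[OF assms(1) d[OF assms(2)] d[OF assms(3)] d[OF sub]]]
    by simp
qed

lemma dim_mono:
  assumes "subfield F R" "subalgebra F A R" "subalgebra F B R" "A \<subseteq> B"
  shows "dim F A \<le> dim F B"
proof -
  obtain Bs where Bs: "independent F Bs" "length Bs = dim F A" "Span F Bs = A" "set Bs \<subseteq> carrier R"
    using exists_base[OF assms(1) dimension_dim[OF assms(1,2)]] by auto
  then have "set Bs \<subseteq> B" using Span_base_incl[OF assms(1)] assms(4) by blast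
  then show ?thesis
    using independent_length_le_dimension[OF assms(1) dimension_dim[OF assms(1,3)] Bs(1)] Bs(2) by simp
qed

lemma dim_subset_eq:
  assumes "subfield F R" "subalgebra F A R" "subalgebra F B R" "A \<subseteq> B" "dim F B \<le> dim F A"
  shows "A = B"
proof -
  obtain Bs where Bs: "independent F Bs" "length Bs = dim F A" "Span F Bs = A" "set Bs \<subseteq> carrier R"
    using exists_base[OF assms(1) dimension_dim[OF assms(1,2)]] by auto
  then have "set Bs \<subseteq> B" using Span_base_incl[OF assms(1)] assms(4) by blast
  moreover have "dim F A = dim F B" using assms dim_mono by (simp add: le_antisym)
  ultimately show ?thesis
    using independent_length_eq_dimension[OF assms(1) dimension_dim[OF assms(1,3)] Bs(1)] Bs(2,3) by simp
qed

lemma dim_zero: "subfield F R \<Longrightarrow> dim F {\<zero>} = 0"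
  using dim_eqI zero_dim by blast

lemma subalgebra_triv: "subfield F R \<Longrightarrow> subalgebra F {\<zero>} R"
  using subfieldE(3)[of F R] by (intro subalgebraI) (auto simp: subset_iff)

lemma dim_eq_0_iff:
  assumes "subfield F R" "subalgebra F A R"
  shows "dim F A = 0 \<longleftrightarrow> A = {\<zero>}"
  using dimension_dim[OF assms] dimension_zero[OF assms(1)] dim_zero[OF assms(1)] by fastforce

lemma dim_self: "subfield F R \<Longrightarrow> dim F F = 1"
  using dim_eqI dimension_one by blast

text \<open>Grassmann's formula with \<open>A + B\<close> bounded by \<open>C\<close>. Most
  estimates on intersections below are instances, with \<open>C\<close> an ambient space over the
  larger field or \<open>S\<close> itself.\<close>

lemma dim_Int_ge:
  assumes "subfield F R" "subalgebra F A R" "subalgebra F B R" "subalgebra F C R" "A \<subseteq> C" "B \<subseteq> C"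
  shows "dim F A + dim F B \<le> dim F C + dim F (A \<inter> B)"
  using dim_set_add[OF assms(1-3)] set_add_subset[OF assms(4-6)]
    dim_mono[OF assms(1) subalgebra_set_add[OF assms(1-3)] assms(4)] by simp

lemma dim_tower:
  assumes "subfield F R" "subfield H R" "F \<subseteq> H" "subalgebra H A R"
  shows "dim F A = dim F H * dim H A"
  using telescopic_base[OF assms(1,2) dimension_dim[OF assms(1) subfield_subalgebra] dimension_dim[OF assms(2,4)]]
    assms dim_eqI by simp

lemma dim_pos:
  assumes "subfield F R" "subalgebra F A R" "A \<noteq> {\<zero>}"
  shows "dim F A > 0"
  using dim_eq_0_iff[OF assms(1,2)] assms(3) by simp

lemma dim_subfield_dvd:
  assumes "subfield F R" "subfield H R" "F \<subseteq> H" "subalgebra H A R"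
  shows "dim F H dvd dim F A"
  using dim_tower[OF assms] by simp

text \<open>Each extension by one basis vector multiplies the cardinality by that of the field. This
  turns the hypotheses on \<open>q\<close> and \<open>n\<close> into dimensions over
  \<open>K\<close>.\<close>

lemma card_dimension:
  assumes "subfield F R" "dimension n F A"
  shows "card A = card F ^ n"
  using assms(2,1)
proof (induction rule: dimension.induct)
  case (zero_dim K)
  then show ?case by simp
next
  case (Suc_dim v E n K)
  note sf = Suc_dim.prems
  note E = space_subgroup_props[OF sf Suc_dim.hyps(3)]
  have K: "K \<subseteq> carrier R" using subfieldE(3)[OF sf] .
  \<comment> \<open>Two representations of one element put \<open>(k - k') v\<close> into
    \<open>E\<close>; since \<open>v\<close> is outside \<open>E\<close>, the scalar
    vanishes.\<close>
  have inj: "inj_on (\<lambda>(k, e). k \<otimes> v \<oplus> e) (K \<times> E)"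
  proof (rule inj_onI, clarsimp)
    fix k e k' e' assume as: "k \<in> K" "e \<in> E" "k' \<in> K" "e' \<in> E" and eq: "k \<otimes> v \<oplus> e = k' \<otimes> v \<oplus> e'"
    have c: "k \<in> carrier R" "k' \<in> carrier R" "e \<in> carrier R" "e' \<in> carrier R" "v \<in> carrier R"
      using as K E(1) Suc_dim.hyps(1) by auto
    have "(k \<ominus> k') \<otimes> v = e' \<ominus> e"
    proof -
      have "(k \<ominus> k') \<otimes> v = (k \<otimes> v \<oplus> e) \<oplus> (\<ominus> (k' \<otimes> v) \<ominus> e)"
        using c by (simp add: minus_eq l_distr l_minus a_ac r_neg1 r_neg2)
      also have "\<dots> = e' \<ominus> e" unfolding eq using c by (simp add: minus_eq a_ac r_neg r_neg1 r_neg2)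
      finally show ?thesis .
    qed
    moreover have "e' \<ominus> e \<in> E" using as E(3,4) by (simp add: minus_eq)
    moreover have "k \<ominus> k' \<in> K"
      using as subringE(5,7)[OF subfieldE(1)[OF sf]] by (simp add: minus_eq)
    ultimately have "k \<ominus> k' = \<zero>"
      using E(6)[of "k \<ominus> k'" v] Suc_dim.hyps(1,2) by auto
    then have "k = k'" using c by simp
    then show "k = k' \<and> e = e'" using eq c by simp
  qed
  have "line_extension K v E = (\<lambda>(k, e). k \<otimes> v \<oplus> e) ` (K \<times> E)"
    by (fastforce simp: line_extension_mem_iff)
  then have "card (line_extension K v E) = card (K \<times> E)"
    using card_image[OF inj] by simp
  then show ?case using Suc_dim.IH[OF sf] by (simp add: card_cartesian_product)
qed

lemma card_eq_dim: "subfield F R \<Longrightarrow> subalgebra F A R \<Longrightarrow> card A = card F ^ dim F A"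
  using card_dimension dimension_dim by blast

lemma finite_subset_carrier: "A \<subseteq> carrier R \<Longrightarrow> finite A"
  using finite_carrier finite_subset by blast

lemma card_subfield_ge_2:
  assumes "subfield F R"
  shows "card F \<ge> 2"
proof -
  have "{\<zero>, \<one>} \<subseteq> F" using subringE(2,3)[OF subfieldE(1)[OF assms]] by simp
  then have "card {\<zero>, \<one>} \<le> card F"
    using card_mono finite_subset_carrier[OF subfieldE(3)[OF assms]] by blast
  then show ?thesis by simp
qed

section \<open>Stabilizers and adjunction\<close>

definition stab :: "'a set \<Rightarrow> 'a set"
  where "stab A = {c \<in> carrier R. c <# A \<subseteq> A}"

lemma stab_iff: "A \<subseteq> carrier R \<Longrightarrow> c \<in> stab A \<longleftrightarrow> c \<in> carrier R \<and> (\<forall>a\<in>A. c \<otimes> a \<in> A)"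
  unfolding stab_def l_coset_def by auto

lemma card_l_coset:
  assumes "a \<in> carrier R - {\<zero>}" "A \<subseteq> carrier R"
  shows "card (a <# A) = card A"
proof -
  have "inj_on ((\<otimes>) a) A"
    using assms m_lcancel by (auto simp: inj_on_def subset_iff)
  moreover have "a <# A = (\<otimes>) a ` A" unfolding l_coset_def by auto
  ultimately show ?thesis using card_image by fastforce
qed

lemma l_coset_stable_eq:
  assumes "a \<in> carrier R - {\<zero>}" "A \<subseteq> carrier R" "a <# A \<subseteq> A"
  shows "a <# A = A"
  using card_subset_eq[OF finite_subset_carrier[OF assms(2)] assms(3) card_l_coset[OF assms(1,2)]] .

lemma inv_nonzero: "a \<in> carrier R - {\<zero>} \<Longrightarrow> inv a \<in> carrier R - {\<zero>}"
  using field_Units by (metis Units_inv_Units)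

lemma subfield_stab:
  assumes "subfield F R" "subalgebra F A R"
  shows "subfield (stab A) R"
proof (rule subfieldI')
  have A: "A \<subseteq> carrier R" using assms subalgebra_in_carrier by blast
  note iff = stab_iff[OF A]
  show "subring (stab A) R"
  proof (rule subringI)
    show "stab A \<subseteq> carrier R" unfolding stab_def by auto
    show "\<one> \<in> stab A" using A by (auto simp: iff)
    show "\<ominus> h \<in> stab A" if "h \<in> stab A" for h
      using that A subalgebra_uminus[OF assms(2)] by (auto simp: iff l_minus subset_iff)
    show "h1 \<otimes> h2 \<in> stab A" if "h1 \<in> stab A" "h2 \<in> stab A" for h1 h2
      using that A by (auto simp: iff m_assoc subset_iff)
    show "h1 \<oplus> h2 \<in> stab A" if "h1 \<in> stab A" "h2 \<in> stab A" for h1 h2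
      using that A subalgebra_add[OF assms(2)] by (auto simp: iff l_distr subset_iff)
  qed
  \<comment> \<open>Finiteness enters here: multiplication by \<open>c\<close> is injective, so
    \<open>c A \<subseteq> A\<close> forces \<open>c A = A\<close>, which can be inverted.\<close>
  show "inv c \<in> stab A" if "c \<in> stab A - {\<zero>}" for c
  proof -
    have c: "c \<in> carrier R - {\<zero>}" "c <# A \<subseteq> A" using that unfolding stab_def by auto
    then have "inv c <# A = A"
      using l_coset_stable_eq[OF c(1) A c(2)] l_coset_inv_cancel(1)[OF c(1) A] by simp
    then show ?thesis using inv_nonzero[OF c(1)] unfolding stab_def by auto
  qed
qed

lemma subfield_subset_stab:
  assumes "subfield F R" "subalgebra F A R"
  shows "F \<subseteq> stab A"
  using subalgebra.smult_closed[OF assms(2)] subfieldE(3)[OF assms(1)]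
  by (auto simp: stab_iff[OF subalgebra_in_carrier[OF assms(2)]])

lemma subalgebra_stab:
  assumes "subfield F R" "subalgebra F A R"
  shows "subalgebra (stab A) A R"
  using assms(2) stab_iff[OF subalgebra_in_carrier[OF assms(2)]]
  by (auto simp: subalgebra_def subalgebra_axioms_def)

abbreviation adjoin :: "'a set \<Rightarrow> 'a \<Rightarrow> 'a set"
  where "adjoin F x \<equiv> generate_field R (insert x F)"

lemma adjoin_props:
  assumes "subfield F R" "x \<in> carrier R"
  shows "subfield (adjoin F x) R" "F \<subseteq> adjoin F x" "x \<in> adjoin F x"
    "subalgebra F (adjoin F x) R"
proof -
  have c: "insert x F \<subseteq> carrier R" using assms subfieldE(3) by auto
  show 1: "subfield (adjoin F x) R" by (rule generate_field_is_subfield[OF c])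
  show 2: "F \<subseteq> adjoin F x" "x \<in> adjoin F x" using generate_fieldE(2)[OF c refl] by auto
  show "subalgebra F (adjoin F x) R" using subfield_subalgebra 1 2 assms by blast
qed

lemma adjoin_minimal:
  assumes "subfield E R" "F \<subseteq> E" "x \<in> E"
  shows "adjoin F x \<subseteq> E"
  using generate_field_min_subfield1[of "insert x F" E] assms subfieldE(3) by blast

text \<open>The field \<open>stab A\<close> contains \<open>F\<close> and \<open>x\<close>, hence
  all of \<open>F(x)\<close>.\<close>

lemma subalgebra_adjoin:
  assumes "subfield F R" "subalgebra F A R" "x \<in> carrier R" "x <# A \<subseteq> A"
  shows "subalgebra (adjoin F x) A R"
proof -
  have "x \<in> stab A" using assms unfolding stab_def by simp
  then have "adjoin F x \<subseteq> stab A"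
    using adjoin_minimal subfield_stab subfield_subset_stab assms by blast
  then show ?thesis
    using subalgebra_restrict subalgebra_stab[OF assms(1,2)] by blast
qed

lemma l_coset_subalgebra_subset:
  assumes "subalgebra H A R" "c \<in> H"
  shows "c <# A \<subseteq> A"
  using subalgebra.smult_closed[OF assms(1) assms(2)] by (auto simp: l_coset_mem_iff)

lemma adjoin_degree_eq_1D:
  assumes "subfield F R" "x \<in> carrier R" "adjoin_degree R F x = 1"
  shows "x \<in> F"
  using dim_subset_eq[OF assms(1) subfield_subalgebra[OF assms(1) subset_refl assms(1)] adjoin_props(4)[OF assms(1,2)]]
    adjoin_props(2,3)[OF assms(1,2)] assms dim_self unfolding adjoin_degree_def by simp

lemma line_eq: "v \<in> carrier R \<Longrightarrow> F \<subseteq> carrier R \<Longrightarrow> F #> v = v <# F"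
  unfolding r_coset_def l_coset_def by (intro SUP_cong refl) (simp add: m_comm subset_iff)

lemma dim_add_line:
  assumes "subfield F R" "subalgebra F A R" "v \<in> carrier R" "v \<notin> A"
  shows "dim F (A <+>\<^bsub>R\<^esub> (v <# F)) = Suc (dim F A)"
proof -
  have F: "F \<subseteq> carrier R" using assms subfieldE(3) by blast
  have "dimension (Suc (dim F A)) F (line_extension F v A)"
    using Suc_dim[OF assms(3,4) dimension_dim[OF assms(1,2)]] .
  moreover have "line_extension F v A = A <+>\<^bsub>R\<^esub> (v <# F)"
    unfolding line_extension_def
    using line_eq[OF assms(3) F] set_add_comm subalgebra_in_carrier[OF assms(2)] l_coset_in_carrier[OF assms(3) F] by simp
  ultimately show ?thesis using dim_eqI assms(1) by simp
qed

lemma line_subset: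
  assumes "subfield F R" "subalgebra F B R" "v \<in> B"
  shows "v <# F \<subseteq> B"
proof
  fix w assume "w \<in> v <# F"
  then obtain c where c: "c \<in> F" "w = v \<otimes> c" by (auto simp: l_coset_mem_iff)
  have "v \<in> carrier R" "c \<in> carrier R"
    using c(1) assms(3) subalgebra_in_carrier[OF assms(2)] subfieldE(3)[OF assms(1)] by auto
  then show "w \<in> B" using subalgebra.smult_closed[OF assms(2) c(1) assms(3)] c(2) by (simp add: m_comm)
qed

lemma add_line_eq:
  assumes "subfield F R" "subalgebra F A R" "subalgebra F B R" "A \<subseteq> B" "v \<in> B" "v \<notin> A"
    "dim F B = Suc (dim F A)"
  shows "B = A <+>\<^bsub>R\<^esub> (v <# F)"
proof -
  have v: "v \<in> carrier R" using assms subalgebra_in_carrier by blast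
  have vF: "v <# F \<subseteq> B"
    using line_subset[OF assms(1,3,5)] .
  have "subalgebra F (A <+>\<^bsub>R\<^esub> (v <# F)) R"
    using assms subalgebra_set_add subalgebra_l_coset v subfield_subalgebra by blast
  then show ?thesis
    using dim_subset_eq[OF assms(1) _ assms(3) set_add_subset[OF assms(3,4) vF]]
      dim_add_line[OF assms(1,2) v assms(6)] assms(7) by simp
qed

section \<open>Spans of consecutive powers\<close>

text \<open>The values at \<open>x\<close> of the polynomials over \<open>F\<close> of degree below
  \<open>s\<close>.\<close>

definition pspan :: "'a set \<Rightarrow> 'a \<Rightarrow> nat \<Rightarrow> 'a set"
  where "pspan F x s = Span F (powers_below R x s)"

lemma powers_below_carrier: "x \<in> carrier R \<Longrightarrow> set (powers_below R x s) \<subseteq> carrier R"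
  unfolding powers_below_def by auto

lemma subalgebra_pspan:
  assumes "subfield F R" "x \<in> carrier R"
  shows "subalgebra F (pspan F x s) R"
  unfolding pspan_def by (rule Span_is_subalgebra[OF assms(1) powers_below_carrier[OF assms(2)]])

lemma pspan_carrier: "subfield F R \<Longrightarrow> x \<in> carrier R \<Longrightarrow> pspan F x s \<subseteq> carrier R"
  using subalgebra_pspan subalgebra_in_carrier by blast

lemma pspan_0 [simp]: "pspan F x 0 = {\<zero>}"
  unfolding pspan_def powers_below_def by simp

lemma l_coset_Span:
  assumes "subfield F R" "a \<in> carrier R" "set us \<subseteq> carrier R"
  shows "a <# Span F us = Span F (map ((\<otimes>) a) us)"
  using assms(3)
proof (induction us)
  case Nil
  then show ?case using assms by (auto simp: l_coset_def)
next
  case (Cons u us)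
  have "Span F us \<subseteq> carrier R"
    using Span_in_carrier[OF subfieldE(3)[OF assms(1)]] Cons.prems by simp
  then show ?case
    using Cons l_coset_line_extension[OF assms(2) subfieldE(3)[OF assms(1)]] by simp
qed

lemma pspan_add:
  assumes "subfield F R" "x \<in> carrier R"
  shows "pspan F x (i + j) = pspan F x i <+>\<^bsub>R\<^esub> (x [^] i <# pspan F x j)"
proof -
  have "[0..<i + j] = [0..<i] @ map ((+) i) [0..<j]"
    by (rule nth_equalityI) (auto simp: nth_append)
  then have "powers_below R x (i + j) = powers_below R x i @ map ((\<otimes>) (x [^] i)) (powers_below R x j)"
    using nat_pow_mult[OF assms(2)] by (simp add: powers_below_def)
  moreover have "set (map ((\<otimes>) (x [^] i)) (powers_below R x j)) \<subseteq> carrier R"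
    using assms(2) by (auto simp: powers_below_def)
  ultimately show ?thesis
    unfolding pspan_def
    using Span_append_eq_set_add[OF assms(1) powers_below_carrier[OF assms(2)]]
      l_coset_Span[OF assms(1) _ powers_below_carrier[OF assms(2)]] assms(2) by simp
qed

lemma pspan_1:
  assumes "subfield F R" "x \<in> carrier R"
  shows "pspan F x 1 = F"
proof -
  have "pspan F x 1 = (F #> \<one>) <+>\<^bsub>R\<^esub> {\<zero>}"
    by (simp add: pspan_def powers_below_def line_extension_def)
  also have "\<dots> = F" using subfieldE(3)[OF assms(1)]
    unfolding set_add_def' r_coset_def by (auto simp: subset_iff)
  finally show ?thesis .
qed

lemma pspan_Suc:
  assumes "subfield F R" "x \<in> carrier R"
  shows "pspan F x (Suc s) = pspan F x s <+>\<^bsub>R\<^esub> (x [^] s <# F)"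
    "pspan F x (Suc s) = F <+>\<^bsub>R\<^esub> (x <# pspan F x s)"
  using pspan_add[OF assms, of s 1] pspan_add[OF assms, of 1 s] pspan_1[OF assms] assms(2) by simp_all

lemma pspan_mono:
  assumes "subfield F R" "x \<in> carrier R" "i \<le> j"
  shows "pspan F x i \<subseteq> pspan F x j"
proof -
  have "pspan F x i \<subseteq> pspan F x (i + (j - i))"
    unfolding pspan_add[OF assms(1,2)]
    by (rule subset_set_add(1)[OF subalgebra_pspan[OF assms(1,2)]
      subalgebra_l_coset[OF assms(1) subalgebra_pspan[OF assms(1,2)] nat_pow_closed[OF assms(2)]]])
  then show ?thesis using assms(3) by simp
qed

lemma power_l_coset_pspan_subset:
  assumes "subfield F R" "x \<in> carrier R"
  shows "x [^] i <# pspan F x j \<subseteq> pspan F x (i + j)"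
  unfolding pspan_add[OF assms]
  by (rule subset_set_add(2)[OF subalgebra_pspan[OF assms]
    subalgebra_l_coset[OF assms(1) subalgebra_pspan[OF assms] nat_pow_closed[OF assms(2)]]])

lemma l_coset_pspan_subset:
  assumes "subfield F R" "x \<in> carrier R"
  shows "x <# pspan F x j \<subseteq> pspan F x (Suc j)"
  using power_l_coset_pspan_subset[OF assms, of 1 j] assms(2) by simp

lemma subfield_one: "subfield F R \<Longrightarrow> \<one> \<in> F"
  using subringE(3)[OF subfieldE(1)] .

lemma mem_l_coset: "b \<in> A \<Longrightarrow> a \<otimes> b \<in> a <# A"
  by (auto simp: l_coset_mem_iff)

lemma power_in_pspan:
  assumes "subfield F R" "x \<in> carrier R" "i < j"
  shows "x [^] i \<in> pspan F x j"
proof -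
  have "x [^] i \<otimes> \<one> \<in> x [^] i <# F" by (rule mem_l_coset[OF subfield_one[OF assms(1)]])
  moreover have "x [^] i <# F \<subseteq> pspan F x (i + 1)"
    using power_l_coset_pspan_subset[OF assms(1,2), of i 1] pspan_1[OF assms(1,2)] by simp
  ultimately show ?thesis
    using pspan_mono[OF assms(1,2), of "i + 1" j] assms by auto
qed

lemma one_in_pspan: "subfield F R \<Longrightarrow> x \<in> carrier R \<Longrightarrow> 0 < j \<Longrightarrow> \<one> \<in> pspan F x j"
  using power_in_pspan[of F x 0 j] by simp

lemma pspan_in_adjoin:
  assumes "subfield F R" "x \<in> carrier R"
  shows "pspan F x s \<subseteq> adjoin F x"
proof -
  have "set (powers_below R x s) \<subseteq> adjoin F x"
  proof -
    have "x [^] i \<in> adjoin F x" for i :: nat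
      using adjoin_props[OF assms] subringE(3,6)[OF subfieldE(1)[OF adjoin_props(1)[OF assms]]]
      by (induction i) auto
    then show ?thesis by (auto simp: powers_below_def)
  qed
  then show ?thesis
    unfolding pspan_def using subalgebra_Span_incl[OF assms(1) adjoin_props(4)[OF assms]] by simp
qed

text \<open>The span is a space over \<open>F(x)\<close> and contains \<open>\<one>\<close>, so it
  contains \<open>F(x)\<close>.\<close>

lemma pspan_stable:
  assumes "subfield F R" "x \<in> carrier R" "0 < s" "x <# pspan F x s \<subseteq> pspan F x s"
  shows "pspan F x s = adjoin F x"
proof
  have "subalgebra (adjoin F x) (pspan F x s) R"
    by (rule subalgebra_adjoin[OF assms(1) subalgebra_pspan[OF assms(1,2)] assms(2,4)])
  then have "c \<otimes> \<one> \<in> pspan F x s" if "c \<in> adjoin F x" for c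
    using that one_in_pspan[OF assms(1-3)] by (rule subalgebra.smult_closed)
  then show "adjoin F x \<subseteq> pspan F x s"
    using subfieldE(3)[OF adjoin_props(1)[OF assms(1,2)]] by force
qed (rule pspan_in_adjoin[OF assms(1,2)])

lemma dim_pspan:
  assumes "subfield F R" "x \<in> carrier R" "s \<le> adjoin_degree R F x"
  shows "dim F (pspan F x s) = s"
  using assms(3)
proof (induction s)
  case 0
  then show ?case using dim_zero[OF assms(1)] by simp
next
  case (Suc s)
  \<comment> \<open>Otherwise the span of the lower powers is stable under \<open>x\<close>, hence
    equal to \<open>F(x)\<close>, whose dimension exceeds \<open>s\<close>.\<close>
  have "x [^] s \<notin> pspan F x s"
  proof
    assume xs: "x [^] s \<in> pspan F x s"
    note sp = subalgebra_pspan[OF assms(1,2), of s]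
    have s: "0 < s" using xs by (cases s) auto
    have "x [^] s <# F \<subseteq> pspan F x s"
      using line_subset[OF assms(1) sp xs] .
    then have "pspan F x (Suc s) \<subseteq> pspan F x s"
      unfolding pspan_Suc(1)[OF assms(1,2)] using set_add_subset[OF sp] by simp
    then have "pspan F x s = adjoin F x"
      using pspan_stable[OF assms(1,2) s] l_coset_pspan_subset[OF assms(1,2), of s] by blast
    then show False using Suc by (simp add: adjoin_degree_def)
  qed
  then show ?case
    unfolding pspan_Suc(1)[OF assms(1,2)]
    using dim_add_line[OF assms(1) subalgebra_pspan[OF assms(1,2)]] Suc assms(2) by simp
qed

lemma pspan_degree:
  assumes "subfield F R" "x \<in> carrier R"
  shows "pspan F x (adjoin_degree R F x) = adjoin F x"
  using dim_subset_eq[OF assms(1) subalgebra_pspan[OF assms] adjoin_props(4)[OF assms] pspan_in_adjoin[OF assms]]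
    dim_pspan[OF assms order_refl] by (simp add: adjoin_degree_def)

lemma dim_pspan_le:
  assumes "subfield F R" "x \<in> carrier R"
  shows "dim F (pspan F x s) \<le> s"
proof (cases "s \<le> adjoin_degree R F x")
  case False
  then show ?thesis
    using dim_mono[OF assms(1) subalgebra_pspan[OF assms] adjoin_props(4)[OF assms] pspan_in_adjoin[OF assms], of s]
    by (simp add: adjoin_degree_def)
qed (use dim_pspan[OF assms] in simp)

lemma pspan_not_stable:
  assumes "subfield F R" "x \<in> carrier R" "0 < s" "s < adjoin_degree R F x"
  shows "\<not> x <# pspan F x s \<subseteq> pspan F x s"
  using pspan_stable[OF assms(1-3)] dim_pspan[OF assms(1,2), of s] assms(4) by (auto simp: adjoin_degree_def)

section \<open>Shifts of codimension one\<close>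

lemma dim_l_coset_subalgebra: "subfield F R \<Longrightarrow> subalgebra F A R \<Longrightarrow> a \<in> carrier R - {\<zero>} \<Longrightarrow> dim F (a <# A) = dim F A"
  using dim_l_coset subalgebra_in_carrier by blast

text \<open>The subspace of all \<open>s \<in> S\<close> with \<open>x s \<in> S\<close> has codimension at most one in \<open>S\<close>, and
  so has its own analogue; iterating this ends in an \<open>x\<close>-stable subspace.\<close>

lemma shift_decomposition_aux:
  assumes "subfield F R" "x \<in> carrier R - {\<zero>}" "subalgebra F S R"
    "dim F S = Suc (dim F (S \<inter> (x <# S)))"
  shows "\<exists>T y r. subalgebra F T R \<and> x <# T \<subseteq> T \<and> y \<in> S \<and> 1 \<le> r \<and>
           S = T <+>\<^bsub>R\<^esub> (y <# pspan F x r) \<and> dim F S = dim F T + r"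
  using assms(3,4)
proof (induction "dim F S" arbitrary: S rule: less_induct)
  case less
  note F = assms(1)
  have x: "x \<in> carrier R" using assms(2) by simp
  note S = less.prems(1)
  have Sc: "S \<subseteq> carrier R" using S subalgebra_in_carrier by blast
  define S' where "S' = S \<inter> (inv x <# S)"
  have S': "subalgebra F S' R" "S' \<subseteq> S"
    unfolding S'_def using S subalgebra_inter subalgebra_l_coset[OF F S] inv_nonzero[OF assms(2)] by auto
  have S'c: "S' \<subseteq> carrier R" using S' Sc by blast
  have xS': "x <# S' = S \<inter> (x <# S)"
    unfolding S'_def using l_coset_Int[OF assms(2) Sc l_coset_in_carrier[OF _ Sc]]
      l_coset_inv_cancel(2)[OF assms(2) Sc] inv_nonzero[OF assms(2)] by auto
  note sx = subalgebra_l_coset[OF F S'(1) x]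
  have dS': "dim F S = Suc (dim F S')" "dim F (x <# S') = dim F S'"
    using dim_l_coset_subalgebra[OF F S'(1) assms(2)] less.prems(2) xS' by simp_all
  show ?case
  proof (cases "x <# S' \<subseteq> S'")
    case True
    have "S' \<noteq> S" using dS' by auto
    then obtain y where y: "y \<in> S" "y \<notin> S'" using S'(2) by blast
    have "S = S' <+>\<^bsub>R\<^esub> (y <# pspan F x 1)"
      unfolding pspan_1[OF F x] using add_line_eq[OF F S'(1) S S'(2) y] dS' by simp
    then show ?thesis using True S' y dS' by (intro exI[of _ S'] exI[of _ y] exI[of _ "1::nat"]) simp
  next
    case False
    have sub: "subalgebra F (S' \<inter> (x <# S')) R" using subalgebra_inter[OF S'(1) sx] .
    have "dim F (S' \<inter> (x <# S')) \<noteq> dim F S'"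
    proof
      assume "dim F (S' \<inter> (x <# S')) = dim F S'"
      then have "S' \<inter> (x <# S') = x <# S'"
        using dim_subset_eq[OF F sub sx] dS' by simp
      then show False using False by blast
    qed
    moreover have "dim F (S' \<inter> (x <# S')) \<le> dim F S'"
      using dim_mono[OF F sub S'(1)] by simp
    \<comment> \<open>\<open>S'\<close> and \<open>x S'\<close> both have codimension one in
      \<open>S\<close>, so their intersection has codimension at most one in \<open>S'\<close>.
      Non-stability makes it exactly one, the premise of the induction.\<close>
    moreover have xS'S: "x <# S' \<subseteq> S" using xS' by blast
    then have "dim F S' + dim F (x <# S') \<le> dim F S + dim F (S' \<inter> (x <# S'))"
      using dim_Int_ge[OF F S'(1) sx S S'(2)] by simp
    ultimately have d1: "dim F S' = Suc (dim F (S' \<inter> (x <# S')))"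
      using dS' by linarith
    then obtain T y r where T: "subalgebra F T R" "x <# T \<subseteq> T" "y \<in> S'" "1 \<le> r"
      "S' = T <+>\<^bsub>R\<^esub> (y <# pspan F x r)" "dim F S' = dim F T + r"
      using less.hyps[OF _ S'(1)] dS' by auto
    have y: "y \<in> carrier R" using T(3) S'c by blast
    note ps = subalgebra_pspan[OF F x]
    have pc: "pspan F x i \<subseteq> carrier R" for i using pspan_carrier[OF F x] .
    note yps = subalgebra_l_coset[OF F ps y]
    \<comment> \<open>One more power of \<open>x\<close> is the expected shape of \<open>S\<close>:
      by dimension \<open>S = S' + x S'\<close>, this sum lies in \<open>Z\<close>, and
      \<open>Z\<close> is no larger than \<open>S\<close>.\<close>
    define Z where "Z = T <+>\<^bsub>R\<^esub> (y <# pspan F x (Suc r))"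
    have Z: "subalgebra F Z R" unfolding Z_def by (rule subalgebra_set_add[OF F T(1) yps])
    have Tc: "T \<subseteq> carrier R" using T(1) subalgebra_in_carrier by blast
    have TZ: "T \<subseteq> Z" "y <# pspan F x (Suc r) \<subseteq> Z"
      unfolding Z_def using subset_set_add[OF T(1) yps] by auto
    have "S' \<subseteq> Z"
      unfolding T(5) Z_def using pspan_mono[OF F x, of r "Suc r"]
      by (intro set_add_mono l_coset_mono) auto
    moreover have "x <# S' \<subseteq> Z"
    proof -
      have "x <# S' = (x <# T) <+>\<^bsub>R\<^esub> (x <# (y <# pspan F x r))"
        unfolding T(5) using l_coset_set_add[OF x Tc l_coset_in_carrier[OF y pc]] .
      also have "x <# (y <# pspan F x r) = y <# (x <# pspan F x r)"
        using l_coset_mult x y pc m_comm[OF x y] by simp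
      also have "(x <# T) <+>\<^bsub>R\<^esub> \<dots> \<subseteq> Z"
        unfolding Z_def by (intro set_add_mono T(2) l_coset_mono l_coset_pspan_subset[OF F x])
      finally show ?thesis .
    qed
    moreover have "S = S' <+>\<^bsub>R\<^esub> (x <# S')"
    proof -
      have "dim F S \<le> dim F (S' <+>\<^bsub>R\<^esub> (x <# S'))"
        using dim_set_add[OF F S'(1) sx] d1 dS' by simp
      then show ?thesis
        using dim_subset_eq[OF F subalgebra_set_add[OF F S'(1) sx] S set_add_subset[OF S S'(2) xS'S]] by simp
    qed
    ultimately have SZ: "S \<subseteq> Z" using set_add_subset[OF Z] by simp
    have "dim F Z \<le> dim F T + dim F (y <# pspan F x (Suc r))"
      unfolding Z_def using dim_set_add[OF F T(1) yps[of "Suc r"]] by linarith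
    also have "dim F (y <# pspan F x (Suc r)) \<le> Suc r"
    proof (cases "y = \<zero>")
      case True
      have "y <# pspan F x (Suc r) \<subseteq> {\<zero>}" using True pc by (auto simp: l_coset_mem_iff subset_iff)
      then show ?thesis using dim_mono[OF F yps subalgebra_triv[OF F]] dim_zero[OF F] by fastforce
    next
      case False
      then show ?thesis using dim_l_coset_subalgebra[OF F ps] dim_pspan_le[OF F x] y by simp
    qed
    finally have "dim F Z \<le> dim F S" using T(6) dS' by simp
    then have "S = Z" using dim_subset_eq[OF F S Z SZ] by simp
    then show ?thesis
      using T dS' S' unfolding Z_def by (intro exI[of _ T] exI[of _ y] exI[of _ "Suc r"]) auto
  qed
qed

lemma adjoin_l_coset_subset:
  assumes "subfield F R" "x \<in> carrier R" "subalgebra (adjoin F x) T R" "y \<in> T"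
  shows "y <# adjoin F x \<subseteq> T"
  using line_subset[OF adjoin_props(1)[OF assms(1,2)] assms(3,4)] .

text \<open>If \<open>y\<close> were in \<open>T\<close>, then \<open>y F(x) \<subseteq> T\<close>
  and \<open>S = T\<close>, against \<open>1 \<le> r\<close>. If \<open>r\<close> reached the degree
  of \<open>x\<close>, then \<open>S\<close> would be stable under \<open>x\<close>, against the
  codimension one.\<close>

lemma shift_decomposition:
  assumes "subfield F R" "x \<in> carrier R - {\<zero>}" "subalgebra F S R"
    "dim F S = Suc (dim F (S \<inter> (x <# S)))"
  obtains T y r where "subalgebra (adjoin F x) T R" "y \<in> S" "y \<notin> T" "1 \<le> r"
    "r < adjoin_degree R F x" "S = T <+>\<^bsub>R\<^esub> (y <# pspan F x r)" "dim F S = dim F T + r"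
proof -
  note F = assms(1)
  have x: "x \<in> carrier R" using assms(2) by simp
  obtain T y r where T: "subalgebra F T R" "x <# T \<subseteq> T" "y \<in> S" "1 \<le> r"
      "S = T <+>\<^bsub>R\<^esub> (y <# pspan F x r)" "dim F S = dim F T + r"
    using shift_decomposition_aux[OF assms] by blast
  note Tx = subalgebra_adjoin[OF F T(1) x T(2)]
  have y: "y \<in> carrier R" using T(3) subalgebra_in_carrier[OF assms(3)] by blast
  have pc: "pspan F x i \<subseteq> carrier R" for i using pspan_carrier[OF F x] .
  note yps = subalgebra_l_coset[OF F subalgebra_pspan[OF F x] y]
  have yT: "y \<notin> T"
  proof
    assume "y \<in> T"
    then have "y <# pspan F x r \<subseteq> T"
      using adjoin_l_coset_subset[OF F x Tx] l_coset_mono[OF pspan_in_adjoin[OF F x, of r]] by blast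
    then have "S \<subseteq> T" unfolding T(5) by (intro set_add_subset[OF T(1)]) auto
    then show False using dim_mono[OF F assms(3) T(1)] T(4,6) by simp
  qed
  then have y0: "y \<in> carrier R - {\<zero>}" using y subalgebra_zero[OF T(1)] by auto
  have "dim F S \<le> dim F T + dim F (y <# pspan F x r)"
    unfolding T(5) using dim_set_add[OF F T(1) yps[of r]] by linarith
  then have le: "r \<le> dim F (pspan F x r)"
    using T(6) dim_l_coset_subalgebra[OF F subalgebra_pspan[OF F x] y0] by simp
  also have "\<dots> \<le> adjoin_degree R F x"
    unfolding adjoin_degree_def
    using dim_mono[OF F subalgebra_pspan[OF F x] adjoin_props(4)[OF F x] pspan_in_adjoin[OF F x]] .
  finally have "r \<le> adjoin_degree R F x" .
  moreover have "r \<noteq> adjoin_degree R F x"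
  proof
    assume r: "r = adjoin_degree R F x"
    have "x <# S = (x <# T) <+>\<^bsub>R\<^esub> (x <# (y <# pspan F x r))"
      unfolding T(5) using l_coset_set_add[OF x subalgebra_in_carrier[OF T(1)] l_coset_in_carrier[OF y pc]] .
    also have "x <# (y <# pspan F x r) = y <# (x <# pspan F x r)"
      using l_coset_mult x y pc m_comm[OF x y] by simp
    also have "(x <# T) <+>\<^bsub>R\<^esub> \<dots> \<subseteq> S"
    proof -
      have "x <# pspan F x r \<subseteq> pspan F x r"
        unfolding r pspan_degree[OF F x]
        using l_coset_subalgebra_subset[OF subfield_subalgebra[OF F] ] adjoin_props[OF F x]
          subringE(6)[OF subfieldE(1)[OF adjoin_props(1)[OF F x]]] by (auto simp: l_coset_mem_iff)
      then show ?thesis unfolding T(5) by (intro set_add_mono T(2) l_coset_mono)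
    qed
    finally have "S \<inter> (x <# S) = x <# S" by blast
    then show False using assms(4) dim_l_coset_subalgebra[OF F assms(3,2)] by simp
  qed
  ultimately show thesis using that[OF Tx T(3) yT T(4) _ T(5,6)] by simp
qed

lemma extend_by_field_line:
  assumes "subfield F R" "subfield H R" "F \<subseteq> H" "subalgebra H T R" "y \<in> carrier R" "y \<notin> T"
  shows "subalgebra H (T <+>\<^bsub>R\<^esub> (y <# H)) R"
    "dim F (T <+>\<^bsub>R\<^esub> (y <# H)) = dim F T + dim F H"
proof -
  have "subalgebra H H R" using subfield_subalgebra[OF assms(2) subset_refl assms(2)] .
  then show 1: "subalgebra H (T <+>\<^bsub>R\<^esub> (y <# H)) R"
    using subalgebra_set_add[OF assms(2,4) subalgebra_l_coset[OF assms(2) _ assms(5)]] by simp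
  show "dim F (T <+>\<^bsub>R\<^esub> (y <# H)) = dim F T + dim F H"
    using dim_add_line[OF assms(2,4-6)] dim_tower[OF assms(1-3) 1] dim_tower[OF assms(1-4)] by simp
qed

section \<open>Subspaces between two spaces over a larger field\<close>

text \<open>An \<open>H\<close>-subspace of \<open>V\<close> not inside \<open>N\<close> meets
  \<open>N\<close> in codimension \<open>dim F H\<close> and \<open>S\<close> in codimension
  \<open>dim F H - r\<close>. Three outcomes result for \<open>V \<inter> a V\<close>: it lies in
  both \<open>N\<close> and \<open>a N\<close>; it lies in exactly one of them, or cuts both in the
  same hyperplane over \<open>H\<close>; it cuts them in two different hyperplanes.\<close>

lemma shift_types:
  assumes "subfield F R" "subfield H R" "F \<subseteq> H"
    and "subalgebra H N R" "subalgebra F S R" "subalgebra H V R" "N \<subseteq> S" "S \<subseteq> V"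
    and "dim F V = dim F N + dim F H" "dim F S = dim F N + r" "r \<le> dim F H"
    and "a \<in> carrier R - {\<zero>}"
  defines "j \<equiv> dim F (N \<inter> (a <# N))" and "s \<equiv> dim F (S \<inter> (a <# S))" and "w \<equiv> dim F (V \<inter> (a <# V))"
  shows "dim F H dvd j \<and> (w = j \<and> s = j \<or>
    w = j + dim F H \<and> j \<le> s \<and> s \<le> j + r \<and> j + 2 * r \<le> s + dim F H \<or>
    w = j + 2 * dim F H \<and> s = j + 2 * r)"
proof -
  note F = assms(1)
  let ?d = "dim F H"
  let ?N = "a <# N" and ?S = "a <# S" and ?V = "a <# V"
  let ?W = "V \<inter> ?V"
  have a: "a \<in> carrier R" using assms(12) by simp
  note H = subalgebra_restrict[OF _ assms(3)]
  note sH = assms(4,6) subalgebra_l_coset[OF assms(2,4) a] subalgebra_l_coset[OF assms(2,6) a]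
  note sF = sH[THEN H] assms(5) subalgebra_l_coset[OF F assms(5) a]
  note i = subalgebra_inter
  have inc: "?N \<subseteq> ?S" "?S \<subseteq> ?V" using assms(7,8) l_coset_mono by auto
  have dimeq: "dim F ?N = dim F N" "dim F ?S = dim F S" "dim F ?V = dim F V"
    using dim_l_coset_subalgebra[OF F _ assms(12)] sF by auto
  have W: "subalgebra H ?W R" "subalgebra F ?W R" using i[OF sH(2,4)] H by auto
  have dvd: "?d dvd dim F A" if "subalgebra H A R" for A
    using dim_subfield_dvd[OF assms(1-3) that] .
  have dj: "?d dvd j" unfolding j_def using dvd i[OF sH(1,3)] by blast
  have dw: "?d dvd w" unfolding w_def using dvd W(1) by blast
  have dpos: "?d > 0"
    using dim_pos[OF F subfield_subalgebra[OF F assms(3,2)]] subfield_one[OF assms(2)] one_not_zero by blast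
  \<comment> \<open>Stated for a generic triple, to be used for \<open>N, S, V\<close> and for their
    translates.\<close>
  have hyper: "dim F (M \<inter> ?W) = w - ?d \<and> dim F (Q \<inter> ?W) = w - ?d + r \<and> ?d \<le> w"
    if M: "subalgebra H M R" "subalgebra F Q R" "subalgebra H P R" "M \<subseteq> Q" "Q \<subseteq> P" "?W \<subseteq> P"
      and dM: "dim F M = dim F N" "dim F Q = dim F S" "dim F P = dim F V" and nW: "\<not> ?W \<subseteq> M" for M Q P
  proof -
    note MF = H[OF M(1)] M(2) H[OF M(3)]
    have MW: "subalgebra H (M \<inter> ?W) R" "subalgebra F (M \<inter> ?W) R" using i[OF M(1) W(1)] H by auto
    have "dim F (M \<inter> ?W) \<noteq> w"
    proof
      assume "dim F (M \<inter> ?W) = w"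
      then have "M \<inter> ?W = ?W" using dim_subset_eq[OF F MW(2) W(2) Int_lower2] unfolding w_def by simp
      then show False using nW by blast
    qed
    moreover have "dim F (M \<inter> ?W) \<le> w"
      unfolding w_def using dim_mono[OF F MW(2) W(2) Int_lower2] .
    ultimately have lt: "dim F (M \<inter> ?W) < w" by simp
    have ge: "w \<le> dim F (M \<inter> ?W) + ?d"
      using dim_Int_ge[OF F MF(1) W(2) MF(3) order_trans[OF M(4,5)] M(6)] dM assms(9)
      unfolding w_def by simp
    have "?d dvd w - dim F (M \<inter> ?W)" using dw dvd[OF MW(1)] by (rule dvd_diff_nat)
    then have "?d \<le> w - dim F (M \<inter> ?W)" using lt by (intro dvd_imp_le) auto
    then have eq: "dim F (M \<inter> ?W) = w - ?d" "?d \<le> w" using ge lt by auto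
    have QW: "subalgebra F (Q \<inter> ?W) R" using i[OF M(2) W(2)] .
    have "dim F Q + dim F ?W \<le> dim F P + dim F (Q \<inter> ?W)"
      using dim_Int_ge[OF F MF(2) W(2) MF(3) M(5,6)] .
    moreover have "dim F M + dim F (Q \<inter> ?W) \<le> dim F Q + dim F (M \<inter> (Q \<inter> ?W))"
      using dim_Int_ge[OF F MF(1) QW MF(2) M(4) Int_lower1] .
    moreover have "M \<inter> (Q \<inter> ?W) = M \<inter> ?W" using M by blast
    ultimately have "dim F (Q \<inter> ?W) = w - ?d + r"
      using eq dM assms(9,10) unfolding w_def by simp
    then show ?thesis using eq by simp
  qed
  have h1: "dim F (N \<inter> ?W) = w - ?d \<and> dim F (S \<inter> ?W) = w - ?d + r \<and> ?d \<le> w" if "\<not> ?W \<subseteq> N"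
    using hyper[OF sH(1) sF(5) sH(2) assms(7,8)] that by simp
  have h2: "dim F (?N \<inter> ?W) = w - ?d \<and> dim F (?S \<inter> ?W) = w - ?d + r \<and> ?d \<le> w" if "\<not> ?W \<subseteq> ?N"
    using hyper[OF sH(3) sF(6) sH(4) inc] that dimeq by simp
  have jle: "j \<le> s"
    unfolding j_def s_def using assms(7) inc by (intro dim_mono[OF F i[OF sF(1,3)] i[OF sF(5,6)]]) auto
  consider "?W \<subseteq> N" "?W \<subseteq> ?N" | "?W \<subseteq> N" "\<not> ?W \<subseteq> ?N" | "\<not> ?W \<subseteq> N" "?W \<subseteq> ?N" | "\<not> ?W \<subseteq> N" "\<not> ?W \<subseteq> ?N"
    by blast
  then show ?thesis
  proof cases
    case 1
    then have "N \<inter> ?N = ?W" "S \<inter> ?S = ?W" using assms(7,8) inc by auto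
    then show ?thesis using dj unfolding j_def s_def w_def by simp
  next
    case 2
    then have "N \<inter> ?N = ?N \<inter> ?W" "S \<inter> ?S = ?S \<inter> ?W" using assms(7,8) inc by auto
    then have "j = w - ?d" "s = w - ?d + r" "?d \<le> w" using h2[OF 2(2)] unfolding j_def s_def by auto
    then have "w = j + ?d" "s = j + r" by linarith+
    then show ?thesis using dj assms(11) by simp
  next
    case 3
    then have "N \<inter> ?N = N \<inter> ?W" "S \<inter> ?S = S \<inter> ?W" using assms(7,8) inc by auto
    then have "j = w - ?d" "s = w - ?d + r" "?d \<le> w" using h1[OF 3(1)] unfolding j_def s_def by auto
    then have "w = j + ?d" "s = j + r" by linarith+
    then show ?thesis using dj assms(11) by simp
  next
    case 4
    note h1 = h1[OF 4(1)] and h2 = h2[OF 4(2)]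
    note iF = i[OF sF(1) W(2)] i[OF sF(3) W(2)] i[OF sF(5) W(2)] i[OF sF(6) W(2)]
    have Neq: "(N \<inter> ?W) \<inter> (?N \<inter> ?W) = N \<inter> ?N" and Seq: "(S \<inter> ?W) \<inter> (?S \<inter> ?W) = S \<inter> ?S"
      using assms(7,8) inc by auto
    have jw: "j \<le> w - ?d"
      unfolding j_def using dim_mono[OF F i[OF sF(1,3)] iF(1)] h1 assms(7,8) inc by auto
    have jw2: "w \<le> j + 2 * ?d"
      using dim_Int_ge[OF F iF(1,2) W(2) Int_lower2 Int_lower2] h1 h2 unfolding Neq j_def[symmetric] w_def[symmetric] by auto
    have s1: "w + 2 * r \<le> s + 2 * ?d"
      using dim_Int_ge[OF F iF(3,4) W(2) Int_lower2 Int_lower2] h1 h2 unfolding Seq s_def[symmetric] w_def[symmetric] by auto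
    have s2: "s \<le> w - ?d + r"
      unfolding s_def using dim_mono[OF F i[OF sF(5,6)] iF(3)] h1 assms(8) inc by auto
    \<comment> \<open>The codimension \<open>r\<close> is spent twice: from
      \<open>S \<inter> a S\<close> to \<open>N \<inter> a S\<close>, and from there to
      \<open>N \<inter> a N\<close>.\<close>
    have s3: "s \<le> j + 2 * r"
    proof -
      note iX = i[OF sF(1,6)]
      have "dim F ?N + dim F (N \<inter> ?S) \<le> dim F ?S + dim F (?N \<inter> (N \<inter> ?S))"
        using dim_Int_ge[OF F sF(3) iX sF(6)] inc by auto
      moreover have "?N \<inter> (N \<inter> ?S) = N \<inter> ?N" using inc by blast
      moreover have "dim F N + s \<le> dim F S + dim F (N \<inter> (S \<inter> ?S))"
        unfolding s_def using dim_Int_ge[OF F sF(1) i[OF sF(5,6)] sF(5)] assms(7) by auto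
      moreover have "N \<inter> (S \<inter> ?S) = N \<inter> ?S" using assms(7) by blast
      ultimately show ?thesis using dimeq assms(10) unfolding j_def by simp
    qed
    obtain u v where uv: "w = ?d * u" "j = ?d * v" using dj dw by (auto elim!: dvdE)
    have "j + ?d \<le> w" using jw h1 by linarith
    then have "?d * (v + 1) \<le> ?d * u" using uv by simp
    then have "v + 1 \<le> u" using dpos nat_mult_le_cancel1 by blast
    moreover have "?d * u \<le> ?d * (v + 2)" using jw2 uv by simp
    then have "u \<le> v + 2" using dpos nat_mult_le_cancel1 by blast
    ultimately have "u = v + 1 \<or> u = v + 2" by linarith
    then have "w = j + ?d \<or> w = j + 2 * ?d" using uv by auto
    then show ?thesis using dj s1 s2 s3 jle by auto
  qed
qed

end

lemma mult_gap:
  fixes d t v m :: nat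
  assumes "d * t = d * v + m" "0 < m" "m < 3 * d"
  shows "m = d \<or> m = 2 * d"
proof -
  have "v < t" using assms(1,2) by (metis add_less_same_cancel1 leI le_add1 le_trans mult_le_mono2 nat_add_left_cancel_le not_le)
  then obtain z where z: "t = v + Suc z" using less_iff_Suc_add by auto
  then have m: "m = d * Suc z" using assms(1) by (simp add: algebra_simps)
  then have "d * Suc z < d * 3" using assms(3) by simp
  then have "Suc z < 3" using nat_mult_less_cancel_disj by blast
  then have "z = 0 \<or> z = 1" by linarith
  then show ?thesis using m by auto
qed

context fin_field
begin

section \<open>Attained intersection dimensions and the degree of the larger field\<close>

definition attains :: "'a set \<Rightarrow> 'a set \<Rightarrow> nat \<Rightarrow> bool"
  where "attains F S i \<longleftrightarrow> (\<exists>a \<in> carrier R - {\<zero>}. dim F (S \<inter> (a <# S)) = i)"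

lemma dim_less_stab:
  assumes "subfield F R" "subfield H R" "F \<subseteq> H" "subalgebra H A R" "a \<in> carrier R" "a <# A \<subseteq> A" "a \<notin> H"
  shows "dim F H < dim F (stab A)"
proof -
  have a: "a \<in> stab A" using assms unfolding stab_def by simp
  have HE: "H \<subseteq> stab A" "subfield (stab A) R"
    using subfield_subset_stab subfield_stab assms(2,4) by auto
  have sub: "subalgebra F H R" "subalgebra F (stab A) R"
    using subfield_subalgebra assms HE by blast+
  have "dim F H \<noteq> dim F (stab A)"
    using dim_subset_eq[OF assms(1) sub HE(1)] a assms(7) by auto
  then show ?thesis using dim_mono[OF assms(1) sub HE(1)] by simp
qed

lemma dvd_both_le:
  fixes e :: nat
  assumes "e dvd m" "e dvd m + c" "0 < c"
  shows "e \<le> c"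
  using assms dvd_imp_le by (simp add: dvd_add_right_iff)

lemma attains_imp_degree_2:
  assumes F: "subfield F R" and H: "subfield H R" and FH: "F \<subseteq> H"
    and N: "subalgebra H N R" and S: "subalgebra F S R" and V: "subalgebra H V R"
    and NS: "N \<subseteq> S" and SV: "S \<subseteq> V"
    and dV: "dim F V = dim F N + dim F H" and dS: "dim F S = dim F N + r"
    and r: "1 \<le> r" "r < dim F H" and N0: "N \<noteq> {\<zero>}"
    and att: "\<And>i. 1 \<le> i \<Longrightarrow> i < dim F S \<Longrightarrow> attains F S i"
  shows "dim F H = 2"
proof (rule ccontr)
  let ?d = "dim F H"
  assume "?d \<noteq> 2"
  then have d3: "3 \<le> ?d" using r by simp
  have types: "?d dvd dim F (N \<inter> (a <# N)) \<and>
      (dim F (V \<inter> (a <# V)) = dim F (N \<inter> (a <# N)) \<and> dim F (S \<inter> (a <# S)) = dim F (N \<inter> (a <# N)) \<or>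
       dim F (V \<inter> (a <# V)) = dim F (N \<inter> (a <# N)) + ?d \<and> dim F (N \<inter> (a <# N)) \<le> dim F (S \<inter> (a <# S)) \<and>
         dim F (S \<inter> (a <# S)) \<le> dim F (N \<inter> (a <# N)) + r \<and> dim F (N \<inter> (a <# N)) + 2 * r \<le> dim F (S \<inter> (a <# S)) + ?d \<or>
       dim F (V \<inter> (a <# V)) = dim F (N \<inter> (a <# N)) + 2 * ?d \<and> dim F (S \<inter> (a <# S)) = dim F (N \<inter> (a <# N)) + 2 * r)"
    if "a \<in> carrier R - {\<zero>}" for a
    using shift_types[OF F H FH N S V NS SV dV dS less_imp_le[OF r(2)] that] .
  obtain t where t: "dim F N = ?d * t" using dim_subfield_dvd[OF F H FH N] by (elim dvdE)
  have "t \<noteq> 0" using t dim_pos[OF F subalgebra_restrict[OF N FH] N0] by (intro notI) simp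
  then have tge: "?d \<le> ?d * t" by simp
  \<comment> \<open>By \<open>shift_types\<close>, \<open>dim F N - c\<close> exceeds a multiple of
    d by some e with e = 0, e = 2r or 2r - d \<le> e \<le> r. So c + e is a multiple of d, and its
    size leaves d or 2d.\<close>
  have res: "?d \<le> r + c \<and> 2 * r + c \<le> 2 * ?d \<or> c + 2 * r = ?d \<or> c + 2 * r = 2 * ?d"
    if c: "1 \<le> c" "c < ?d" for c
  proof -
    have "attains F S (?d * t - c)" using tge c dS t by (intro att) linarith+
    then obtain a where a: "a \<in> carrier R - {\<zero>}" "dim F (S \<inter> (a <# S)) = ?d * t - c"
      unfolding attains_def by blast
    obtain v where v: "dim F (N \<inter> (a <# N)) = ?d * v" using types[OF a(1)] by (auto elim!: dvdE)
    have gap: "c + e = ?d \<or> c + e = 2 * ?d" if "?d * t - c = ?d * v + e" "c + e < 3 * ?d" for e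
      using that c tge by (intro mult_gap[of ?d t v "c + e"]) linarith+
    note types[OF a(1), unfolded v a(2)]
    then consider "?d * t - c = ?d * v" | "?d * v \<le> ?d * t - c" "?d * t - c \<le> ?d * v + r" "?d * v + 2 * r \<le> ?d * t - c + ?d"
      | "?d * t - c = ?d * v + 2 * r" by blast
    then show ?thesis
    proof cases
      case 1
      then show ?thesis using gap[of 0] c by simp
    next
      case 2
      define p where "p = ?d * t - c - ?d * v"
      have p: "?d * t - c = ?d * v + p" "p \<le> r" "2 * r \<le> p + ?d" using 2 unfolding p_def by linarith+
      then have "c + p = ?d \<or> c + p = 2 * ?d" using gap[of p] c r by linarith
      then show ?thesis using p c r by linarith
    next
      case 3
      then show ?thesis using gap[of "2 * r"] c r by linarith
    qed
  qed
  \<comment> \<open>The value c = 1 leaves two candidates for \<open>r\<close>, since 2r + 1 = 2d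
    fails by parity. For d \<ge> 4 the candidate r = d - 1 is refuted by c = 3, and 2r + 1 = d by c
    = 2.\<close>
  have 1: "r + 1 = ?d \<or> 2 * r + 1 = ?d" using res[of 1] d3 r by linarith
  have "?d \<le> 3"
  proof (rule ccontr)
    assume d4: "\<not> ?d \<le> 3"
    then show False using 1 res[of 2] res[of 3] by linarith
  qed
  then have d: "?d = 3" using d3 by simp
  have sub_shift: "subalgebra E (A \<inter> (b <# A)) R" if "subfield E R" "subalgebra E A R" "b \<in> carrier R - {\<zero>}" for E A b
    using that subalgebra_inter subalgebra_l_coset by blast
  have t1: "1 \<le> t" using \<open>t \<noteq> 0\<close> by simp
  from 1 d consider "r = 1" | "r = 2" by linarith
  then show False
  proof cases
    case 1
    note T = types[unfolded d 1]
    \<comment> \<open>Dimension 3t - 1 occurs only with two different hyperplanes, so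
      \<open>a V = V\<close> although \<open>a N \<noteq> N\<close>, and \<open>V\<close> has a
      stabilizer larger than \<open>H\<close>. Dimension 3t - 2 then produces a space over this
      stabilizer of dimension 3t, next to \<open>V\<close> of dimension 3t + 3.\<close>
    have "attains F S (3 * t - 1)" using att dS t d t1 1 by simp
    then obtain a where a: "a \<in> carrier R - {\<zero>}" "dim F (S \<inter> (a <# S)) = 3 * t - 1"
      unfolding attains_def by blast
    obtain v where v: "dim F (N \<inter> (a <# N)) = 3 * v" using T[OF a(1)] by (auto elim!: dvdE)
    have w: "dim F (V \<inter> (a <# V)) = 3 * t + 3" "v < t"
      using T[OF a(1), unfolded v a(2)] t1 by presburger+
    have Va: "subalgebra F (V \<inter> (a <# V)) R" "subalgebra F V R"
      using sub_shift[OF H V a(1)] V FH subalgebra_restrict by auto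
    have "V \<inter> (a <# V) = V"
      using dim_subset_eq[OF F Va Int_lower1] w dV t d by simp
    then have aV: "a <# V \<subseteq> V"
      using dim_subset_eq[OF F Va(2) subalgebra_l_coset[OF F Va(2)], of a] a
        dim_l_coset_subalgebra[OF F Va(2) a(1)] by auto
    have aH: "a \<notin> H"
    proof
      assume "a \<in> H"
      then have "a <# N = N"
        using l_coset_stable_eq[OF a(1) subalgebra_in_carrier[OF N]] l_coset_subalgebra_subset[OF N] by blast
      then show False using v w t d by simp
    qed
    let ?E = "stab V"
    have E: "subfield ?E R" "F \<subseteq> ?E" "subalgebra ?E V R"
      using subfield_stab[OF H V] subfield_subset_stab[OF F Va(2)] subalgebra_stab[OF H V] by auto
    have "3 < dim F ?E" using dim_less_stab[OF F H FH V _ aV aH] a d by simp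
    have "attains F S (3 * t - 2)" using att dS t d t1 1 by simp
    then obtain b where b: "b \<in> carrier R - {\<zero>}" "dim F (S \<inter> (b <# S)) = 3 * t - 2"
      unfolding attains_def by blast
    obtain u where u: "dim F (N \<inter> (b <# N)) = 3 * u" using T[OF b(1)] by (auto elim!: dvdE)
    have "dim F (V \<inter> (b <# V)) = 3 * t"
      using T[OF b(1), unfolded u b(2)] t1 by presburger
    then have "dim F ?E dvd 3 * t" using dim_subfield_dvd[OF F E(1,2) sub_shift[OF E(1,3) b(1)]] by simp
    moreover have "dim F ?E dvd 3 * t + 3" using dim_subfield_dvd[OF F E] dV t d by simp
    ultimately show False using dvd_both_le[of "dim F ?E" "3 * t" 3] \<open>3 < dim F ?E\<close> by simp
  next
    case 2
    note T = types[unfolded d 2]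
    \<comment> \<open>The mirror image: now \<open>a N = N\<close> although
      \<open>a V \<noteq> V\<close>, so \<open>N\<close> has the larger stabilizer. Dimension 3(t -
      1) gives a second space over it, three dimensions smaller than \<open>N\<close>. For t = 1 the
      stabilizer degree divides \<open>dim F N = 3\<close> directly.\<close>
    have "attains F S (3 * t)" using att dS t d t1 2 by simp
    then obtain a where a: "a \<in> carrier R - {\<zero>}" "dim F (S \<inter> (a <# S)) = 3 * t"
      unfolding attains_def by blast
    obtain v where v: "dim F (N \<inter> (a <# N)) = 3 * v" using T[OF a(1)] by (auto elim!: dvdE)
    have w: "dim F (V \<inter> (a <# V)) = 3 * t" "v = t"
      using T[OF a(1), unfolded v a(2)] t1 by presburger+
    have Na: "subalgebra F (N \<inter> (a <# N)) R" "subalgebra F N R"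
      using sub_shift[OF H N a(1)] N FH subalgebra_restrict by auto
    have "N \<inter> (a <# N) = N"
      using dim_subset_eq[OF F Na Int_lower1] v w t d by simp
    then have aN: "a <# N \<subseteq> N"
      using dim_subset_eq[OF F Na(2) subalgebra_l_coset[OF F Na(2)], of a] a
        dim_l_coset_subalgebra[OF F Na(2) a(1)] by auto
    have aH: "a \<notin> H"
    proof
      assume "a \<in> H"
      then have "a <# V = V"
        using l_coset_stable_eq[OF a(1) subalgebra_in_carrier[OF V]] l_coset_subalgebra_subset[OF V] by blast
      then show False using w dV t d by simp
    qed
    let ?E = "stab N"
    have E: "subfield ?E R" "F \<subseteq> ?E" "subalgebra ?E N R"
      using subfield_stab[OF H N] subfield_subset_stab[OF F Na(2)] subalgebra_stab[OF H N] by auto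
    have E3: "3 < dim F ?E" using dim_less_stab[OF F H FH N _ aN aH] a d by simp
    have Et: "dim F ?E dvd 3 * t" using dim_subfield_dvd[OF F E] t d by simp
    show False
    proof (cases "t = 1")
      case True
      then show False using Et E3 dvd_imp_le[of "dim F ?E" 3] by simp
    next
      case False
      then obtain t' where t': "t = Suc t'" "1 \<le> t'" using t1 by (cases t) auto
      have "attains F S (3 * t')" using att dS t d t' 2 by simp
      then obtain b where b: "b \<in> carrier R - {\<zero>}" "dim F (S \<inter> (b <# S)) = 3 * t'"
        unfolding attains_def by blast
      obtain u where u: "dim F (N \<inter> (b <# N)) = 3 * u" using T[OF b(1)] by (auto elim!: dvdE)
      have "u = t'" using T[OF b(1), unfolded u b(2)] by presburger
      then have "dim F ?E dvd 3 * t'"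
        using dim_subfield_dvd[OF F E(1,2) sub_shift[OF E(1,3) b(1)]] u by simp
      then show False using dvd_both_le[of "dim F ?E" "3 * t'" 3] Et E3 t' by (simp add: add.commute)
    qed
  qed
qed

section \<open>Bounds from intersections of dimension one and zero\<close>

lemma subfield_Int_l_coset:
  assumes "subfield E R" "a \<in> carrier R" "a \<notin> E"
  shows "E \<inter> (a <# E) = {\<zero>}"
proof -
  \<comment> \<open>A nonzero common element \<open>x = a e\<close> would put
    \<open>a = x / e\<close> into \<open>E\<close>.\<close>
  have "x = \<zero>" if x: "x \<in> E" "x \<in> a <# E" for x
  proof (rule ccontr)
    assume "x \<noteq> \<zero>"
    obtain e where e: "e \<in> E" "x = a \<otimes> e" using x(2) unfolding l_coset_mem_iff by blast
    have c: "e \<in> carrier R" "e \<noteq> \<zero>" using e assms(2) subfieldE(3)[OF assms(1)] \<open>x \<noteq> \<zero>\<close> by (auto simp: subset_iff)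
    have "inv e \<in> E" "e \<otimes> inv e = \<one>"
      using subfield_m_inv[OF assms(1)] e c by auto
    then have "x \<otimes> inv e \<in> E" "x \<otimes> inv e = a"
      using e c x assms(2) subringE(6)[OF subfieldE(1)[OF assms(1)]] m_assoc[of a e "inv e"]
        subfieldE(3)[OF assms(1)] by auto
    then show False using assms(3) by simp
  qed
  moreover have "\<zero> \<in> E" using subringE(2)[OF subfieldE(1)[OF assms(1)]] .
  moreover from this have "\<zero> \<in> a <# E" using assms(2) by (force simp: l_coset_mem_iff)
  ultimately show ?thesis by blast
qed

text \<open>A nonzero intersection forces \<open>a \<in> E\<close>, so \<open>S\<close> and
  \<open>a S\<close> both live in \<open>E\<close> and Grassmann's formula applies inside
  \<open>E\<close>.\<close>

lemma attains_1_bound: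
  assumes "subfield F R" "subfield E R" "F \<subseteq> E" "subalgebra F S R" "S \<subseteq> E" "attains F S 1"
  shows "2 * dim F S \<le> dim F E + 1"
proof -
  obtain a where a: "a \<in> carrier R - {\<zero>}" "dim F (S \<inter> (a <# S)) = 1"
    using assms(6) unfolding attains_def by blast
  have "a \<in> E"
  proof (rule ccontr)
    assume "a \<notin> E"
    then have "E \<inter> (a <# E) = {\<zero>}" using subfield_Int_l_coset[OF assms(2)] a by simp
    moreover have "S \<inter> (a <# S) \<subseteq> E \<inter> (a <# E)" using assms(5) l_coset_mono by blast
    moreover have "\<zero> \<in> S \<inter> (a <# S)"
      using subalgebra_zero[OF assms(4)] subalgebra_zero[OF subalgebra_l_coset[OF assms(1,4), of a]] a by simp
    ultimately have "S \<inter> (a <# S) = {\<zero>}" by blast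
    then show False using a dim_zero[OF assms(1)] by simp
  qed
  then have "a <# S \<subseteq> E"
    using l_coset_mono[OF assms(5)]
      l_coset_subalgebra_subset[OF subfield_subalgebra[OF assms(2) subset_refl assms(2)]] by blast
  then show ?thesis
    using dim_Int_ge[OF assms(1,4) subalgebra_l_coset[OF assms(1,4)] subfield_subalgebra[OF assms(1,3,2)] assms(5), of a]
      dim_l_coset_subalgebra[OF assms(1,4) a(1)] a by simp
qed

lemma attains_0_bound:
  assumes "subfield F R" "subalgebra F S R" "attains F S 0"
  shows "2 * dim F S \<le> dim F (carrier R)"
proof -
  obtain a where a: "a \<in> carrier R - {\<zero>}" "dim F (S \<inter> (a <# S)) = 0"
    using assms(3) unfolding attains_def by blast
  have c: "subalgebra F (carrier R) R" using carrier_is_subalgebra subfieldE(3)[OF assms(1)] .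
  show ?thesis
    using dim_Int_ge[OF assms(1,2) subalgebra_l_coset[OF assms(1,2)] c, of a] a
      subalgebra_in_carrier[OF assms(2)] l_coset_in_carrier[of a S] dim_l_coset_subalgebra[OF assms(1,2) a(1)] by simp
qed

lemma attains_l_coset:
  assumes "subfield F R" "S \<subseteq> carrier R" "c \<in> carrier R - {\<zero>}"
  shows "attains F (c <# S) i \<longleftrightarrow> attains F S i"
proof -
  have "dim F ((c <# S) \<inter> (a <# (c <# S))) = dim F (S \<inter> (a <# S))" if "a \<in> carrier R - {\<zero>}" for a
  proof -
    have "a <# (c <# S) = c <# (a <# S)"
      using l_coset_mult that assms m_comm by auto
    then have "(c <# S) \<inter> (a <# (c <# S)) = c <# (S \<inter> (a <# S))"
      using l_coset_Int[OF assms(3,2)] l_coset_in_carrier assms(2) that by simp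
    then show ?thesis using dim_l_coset[OF assms(1,3), of "S \<inter> (a <# S)"] assms(2) by auto
  qed
  then show ?thesis unfolding attains_def by auto
qed

section \<open>Change of the generator\<close>

text \<open>Substituting \<open>X + c\<close> for the variable does not raise the degree of a
  polynomial; the substitution by \<open>- c\<close> gives the converse inclusion.\<close>

lemma pspan_translate_subset:
  assumes "subfield F R" "x \<in> carrier R" "c \<in> F"
  shows "pspan F (x \<oplus> c) s \<subseteq> pspan F x s"
proof (induction s)
  case (Suc s)
  have c: "c \<in> carrier R" "x \<oplus> c \<in> carrier R" using assms(2,3) subfieldE(3)[OF assms(1)] by auto
  note sp = subalgebra_pspan[OF assms(1,2)]
  have "F \<subseteq> pspan F x (Suc s)"
    using pspan_mono[OF assms(1,2), of 1 "Suc s"] pspan_1[OF assms(1,2)] by simp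
  moreover have "(x \<oplus> c) <# pspan F (x \<oplus> c) s \<subseteq> pspan F x (Suc s)"
  proof
    fix u assume "u \<in> (x \<oplus> c) <# pspan F (x \<oplus> c) s"
    then obtain v where v: "v \<in> pspan F x s" "u = (x \<oplus> c) \<otimes> v"
      using Suc.IH unfolding l_coset_mem_iff by blast
    have vc: "v \<in> carrier R" using v pspan_carrier[OF assms(1,2)] by blast
    have "x \<otimes> v \<in> pspan F x (Suc s)"
      using mem_l_coset[OF v(1)] l_coset_pspan_subset[OF assms(1,2)] by blast
    moreover have "c \<otimes> v \<in> pspan F x (Suc s)"
      using subalgebra.smult_closed[OF sp assms(3) v(1)] pspan_mono[OF assms(1,2), of s "Suc s"] by auto
    ultimately have "x \<otimes> v \<oplus> c \<otimes> v \<in> pspan F x (Suc s)" using subalgebra_add[OF sp] by blast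
    then show "u \<in> pspan F x (Suc s)" using v vc c assms(2) by (simp add: l_distr)
  qed
  ultimately show ?case
    unfolding pspan_Suc(2)[OF assms(1) c(2)] using set_add_subset[OF sp] by simp
qed simp

lemma pspan_translate:
  assumes "subfield F R" "x \<in> carrier R" "c \<in> F"
  shows "pspan F (x \<oplus> c) s = pspan F x s"
proof
  have c: "c \<in> carrier R" "\<ominus> c \<in> F"
    using assms(2,3) subfieldE(3)[OF assms(1)] subringE(5)[OF subfieldE(1)[OF assms(1)]] by auto
  then have "x \<oplus> c \<oplus> \<ominus> c = x" using assms(2) by (simp add: a_assoc r_neg)
  then show "pspan F x s \<subseteq> pspan F (x \<oplus> c) s"
    using pspan_translate_subset[OF assms(1) _ c(2), of "x \<oplus> c"] c assms(2) by simp
qed (rule pspan_translate_subset[OF assms])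

lemma inv_props:
  assumes "x \<in> carrier R - {\<zero>}"
  shows "inv x \<in> carrier R" "inv x \<noteq> \<zero>" "x \<otimes> inv x = \<one>" "inv x \<otimes> x = \<one>"
  using inv_nonzero[OF assms] assms field_Units by auto

text \<open>Reversal of coefficients: a polynomial of degree at most \<open>s\<close> at
  \<open>x\<close> is \<open>x ^ s\<close> times its reversed polynomial at
  \<open>1 / x\<close>.\<close>

lemma pspan_inv:
  assumes "subfield F R" "x \<in> carrier R - {\<zero>}"
  shows "pspan F x (Suc s) = x [^] s <# pspan F (inv x) (Suc s)"
proof (induction s)
  case 0
  have x: "x \<in> carrier R" using assms by simp
  show ?case
    using pspan_1[OF assms(1) x] pspan_1[OF assms(1) inv_props(1)[OF assms(2)]] l_coset_one subfieldE(3)[OF assms(1)]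
    by simp
next
  case (Suc s)
  have x: "x \<in> carrier R" using assms by simp
  note y = inv_props[OF assms(2)]
  have F: "F \<subseteq> carrier R" using subfieldE(3)[OF assms(1)] .
  note pc = pspan_carrier[OF assms(1) y(1)]
  have "x [^] Suc s <# pspan F (inv x) (Suc (Suc s)) =
      (x [^] Suc s <# F) <+>\<^bsub>R\<^esub> (x [^] Suc s <# (inv x <# pspan F (inv x) (Suc s)))"
    unfolding pspan_Suc(2)[OF assms(1) y(1), of "Suc s"]
    using l_coset_set_add F pc l_coset_in_carrier[OF y(1) pc] x by simp
  also have "x [^] Suc s <# (inv x <# pspan F (inv x) (Suc s)) = x [^] s <# pspan F (inv x) (Suc s)"
    using l_coset_mult[OF _ y(1) pc] x y by (simp add: m_assoc)
  also have "\<dots> = pspan F x (Suc s)" using Suc.IH by simp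
  also have "(x [^] Suc s <# F) <+>\<^bsub>R\<^esub> pspan F x (Suc s) = pspan F x (Suc (Suc s))"
    unfolding pspan_Suc(1)[OF assms(1) x, of "Suc s"]
    using set_add_comm[OF l_coset_in_carrier[OF _ F] pspan_carrier[OF assms(1) x]] x by simp
  finally show ?case by simp
qed

text \<open>A \<open>g\<close> outside \<open>pspan F x n\<close> would span
  \<open>pspan F x (Suc n)\<close> together with it; then \<open>x g\<close> lying there makes this
  space stable under \<open>x\<close>, which is impossible below the degree of
  \<open>x\<close>.\<close>

lemma pspan_quotient_step:
  assumes "subfield F R" "x \<in> carrier R" "Suc n < adjoin_degree R F x"
    "g \<in> pspan F x (Suc n)" "x \<otimes> g \<in> pspan F x (Suc n)"
  shows "g \<in> pspan F x n"
proof (rule ccontr)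
  assume g: "g \<notin> pspan F x n"
  note sp = subalgebra_pspan[OF assms(1,2)]
  have gc: "g \<in> carrier R" using assms(4) pspan_carrier[OF assms(1,2)] by blast
  have F: "F \<subseteq> carrier R" using subfieldE(3)[OF assms(1)] .
  have "pspan F x (Suc n) = pspan F x n <+>\<^bsub>R\<^esub> (g <# F)"
    using add_line_eq[OF assms(1) sp sp pspan_mono[OF assms(1,2)] assms(4) g]
      dim_pspan[OF assms(1,2)] assms(3) by simp
  then have "x <# pspan F x (Suc n) = (x <# pspan F x n) <+>\<^bsub>R\<^esub> (x <# (g <# F))"
    using l_coset_set_add[OF assms(2) pspan_carrier[OF assms(1,2)] l_coset_in_carrier[OF gc F]] by simp
  also have "x <# (g <# F) = (x \<otimes> g) <# F" using l_coset_mult[OF assms(2) gc F] .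
  also have "(x <# pspan F x n) <+>\<^bsub>R\<^esub> \<dots> \<subseteq> pspan F x (Suc n)"
    using set_add_subset[OF sp l_coset_pspan_subset[OF assms(1,2)] line_subset[OF assms(1) sp assms(5)]] .
  finally show False using pspan_not_stable[OF assms(1,2) _ assms(3)] by simp
qed

text \<open>If \<open>g\<close> and its multiples up to \<open>x ^ s g\<close> have degree below
  \<open>n + s\<close> as polynomials in \<open>x\<close>, then \<open>g\<close> has degree below
  \<open>n\<close>. The bound by the degree of \<open>x\<close> prevents reduction modulo the
  minimal polynomial.\<close>

lemma pspan_quotient:
  assumes "subfield F R" "x \<in> carrier R" "n + s < adjoin_degree R F x" "g \<in> carrier R"
    "\<And>i. i \<le> s \<Longrightarrow> x [^] i \<otimes> g \<in> pspan F x (n + s)"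
  shows "g \<in> pspan F x n"
  using assms(3-5)
proof (induction s arbitrary: n g)
  case 0
  then show ?case using "0.prems"(3)[of 0] by simp
next
  case (Suc s)
  have "g \<in> pspan F x (Suc n)"
    using Suc.IH[of "Suc n" g] Suc.prems by simp
  moreover have "x \<otimes> g \<in> pspan F x (Suc n)"
  proof (rule Suc.IH)
    show "x [^] i \<otimes> (x \<otimes> g) \<in> pspan F x (Suc n + s)" if "i \<le> s" for i
      using Suc.prems(3)[of "Suc i"] that Suc.prems(2) assms(2) by (simp add: m_assoc)
  qed (use Suc.prems assms(2) in auto)
  ultimately show ?case using pspan_quotient_step[OF assms(1,2)] Suc.prems(1) by simp
qed

lemma pspan_2:
  assumes "subfield F R" "x \<in> carrier R" "g \<in> pspan F x 2"
  obtains a b where "a \<in> F" "b \<in> F" "g = x \<otimes> a \<oplus> b"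
proof -
  have "pspan F x 2 = F <+>\<^bsub>R\<^esub> (x <# F)"
    using pspan_Suc(2)[OF assms(1,2), of 1] pspan_1[OF assms(1,2)] by (simp add: numeral_2_eq_2)
  then obtain b u where bu: "b \<in> F" "u \<in> x <# F" "g = b \<oplus> u" using assms(3) set_add_mem_iff[of g F "x <# F"] by auto
  then obtain a where a: "a \<in> F" "u = x \<otimes> a" unfolding l_coset_mem_iff by blast
  have "a \<in> carrier R" "b \<in> carrier R" using a bu subfieldE(3)[OF assms(1)] by auto
  then have "g = x \<otimes> a \<oplus> b" using a bu assms(2) by (simp add: a_comm)
  then show thesis using that a bu by blast
qed

text \<open>If \<open>z \<in> y (a x + b) F\<close>, then for \<open>a \<noteq> 0\<close> the Moebius transform \<open>1 / (x + b / a)\<close> of \<open>x\<close> serves as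
  the common generator of both spaces.\<close>

lemma nested_pspans:
  assumes "subfield F R" "x \<in> carrier R" "1 \<le> t" "Suc t < adjoin_degree R F x"
    "y \<in> carrier R - {\<zero>}" "z \<in> carrier R - {\<zero>}" "z <# pspan F x t \<subseteq> y <# pspan F x (Suc t)"
  obtains c w where "c \<in> carrier R - {\<zero>}" "w \<in> carrier R"
    "z <# pspan F x t = c <# pspan F w t" "y <# pspan F x (Suc t) = c <# pspan F w (Suc t)"
proof -
  note F = assms(1) and x = assms(2)
  have yz: "y \<in> carrier R" "z \<in> carrier R" using assms by auto
  note iy = inv_props[OF assms(5)]
  note pc = pspan_carrier[OF F]
  define g where "g = inv y \<otimes> z"
  have g: "g \<in> carrier R" "g \<noteq> \<zero>" "z = y \<otimes> g"
    unfolding g_def using yz iy assms(6) integral[of "inv y" z] m_assoc[of y "inv y" z] by auto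
  \<comment> \<open>The multiples of \<open>g = z / y\<close> by the first \<open>t\<close> powers
    of \<open>x\<close> all have degree below \<open>t + 1\<close>, so \<open>g\<close> is a linear
    polynomial in \<open>x\<close>.\<close>
  have "g \<in> pspan F x 2"
  proof (rule pspan_quotient[OF F x, where s = "t - 1"])
    show "2 + (t - 1) < adjoin_degree R F x" using assms(3,4) by simp
    show "x [^] i \<otimes> g \<in> pspan F x (2 + (t - 1))" if "i \<le> t - 1" for i
    proof -
      have "z \<otimes> x [^] i \<in> y <# pspan F x (Suc t)"
        using mem_l_coset[OF power_in_pspan[OF F x, of i t], of z] that assms(3,7) by auto
      then obtain v where v: "v \<in> pspan F x (Suc t)" "z \<otimes> x [^] i = y \<otimes> v" unfolding l_coset_mem_iff by blast
      have vc: "v \<in> carrier R" using v pc[OF x] by blast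
      have "y \<otimes> (x [^] i \<otimes> g) = y \<otimes> v"
        using v(2) g yz x by (simp add: m_ac)
      then have "x [^] i \<otimes> g = v" using m_lcancel[of y "x [^] i \<otimes> g" v] assms(5) g x vc by auto
      moreover have "2 + (t - 1) = Suc t" using assms(3) by simp
      ultimately show ?thesis using v by simp
    qed
  qed (rule g(1))
  then obtain a b where ab: "a \<in> F" "b \<in> F" "g = x \<otimes> a \<oplus> b" using pspan_2[OF F x] by blast
  have abc: "a \<in> carrier R" "b \<in> carrier R" using ab subfieldE(3)[OF F] by auto
  have scale: "h <# pspan F u s = pspan F u s" if "h \<in> F" "h \<noteq> \<zero>" "u \<in> carrier R" for h u s
  proof -
    have "h \<in> carrier R - {\<zero>}" using that subfieldE(3)[OF F] by auto
    then show ?thesis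
      using l_coset_stable_eq[OF _ pc[OF that(3)] l_coset_subalgebra_subset[OF subalgebra_pspan[OF F that(3)] that(1)]] by simp
  qed
  show thesis
  proof (cases "a = \<zero>")
    case True
    then have "g = b" using ab abc x by simp
    then have "z <# pspan F x t = y <# pspan F x t"
      using g l_coset_mult[OF yz(1) abc(2) pc[OF x]] scale[OF ab(2) _ x] by simp
    then show thesis using that[of y x] assms(5) x by simp
  next
    case False
    then have a0: "a \<in> carrier R - {\<zero>}" using abc by simp
    note ia = inv_props[OF a0]
    have iaF: "inv a \<in> F" using subfield_m_inv(1)[OF F] ab False by auto
    define c where "c = b \<otimes> inv a"
    have c: "c \<in> F" unfolding c_def using ab iaF subringE(6)[OF subfieldE(1)[OF F]] by auto
    have cc: "c \<in> carrier R" using c subfieldE(3)[OF F] by auto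
    define u where "u = x \<oplus> c"
    have uc: "u \<in> carrier R" unfolding u_def using x cc by simp
    have gu: "g = a \<otimes> u"
    proof -
      have "a \<otimes> c = b" unfolding c_def using abc ia m_lcomm[of a b "inv a"] by simp
      then show ?thesis unfolding u_def ab using abc x cc by (simp add: r_distr m_comm)
    qed
    then have u0: "u \<in> carrier R - {\<zero>}" using g abc uc by auto
    note iu = inv_props[OF u0]
    have pu: "pspan F x s = pspan F u s" for s unfolding u_def using pspan_translate[OF F x c] by simp
    let ?c = "y \<otimes> u [^] t"
    have un: "u [^] i \<in> carrier R - {\<zero>}" for i :: nat
      using u0 by (induction i) (auto simp: integral_iff)
    have cne: "?c \<in> carrier R - {\<zero>}" using assms(5) un[of t] by (auto simp: integral_iff)
    have "y <# pspan F x (Suc t) = ?c <# pspan F (inv u) (Suc t)"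
      unfolding pu pspan_inv[OF F u0] using l_coset_mult[OF yz(1) _ pc[OF iu(1)]] uc by simp
    moreover have "z <# pspan F x t = ?c <# pspan F (inv u) t"
    proof -
      obtain s where s: "t = Suc s" using assms(3) by (cases t) auto
      have "z <# pspan F x t = (y \<otimes> u \<otimes> a) <# pspan F u t"
        unfolding pu g gu using yz abc uc by (simp add: m_ac)
      also have "\<dots> = (y \<otimes> u) <# pspan F u t"
        using l_coset_mult[OF _ abc(1) pc[OF uc], of "y \<otimes> u"] scale[OF ab(1) False uc] yz uc by simp
      also have "\<dots> = (y \<otimes> u) <# (u [^] s <# pspan F (inv u) t)"
        unfolding s pspan_inv[OF F u0] ..
      also have "\<dots> = (y \<otimes> u \<otimes> u [^] s) <# pspan F (inv u) t"
        using l_coset_mult[OF _ _ pc[OF iu(1)]] yz uc by simp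
      also have "y \<otimes> u \<otimes> u [^] s = ?c" unfolding s using yz uc by (simp add: m_ac)
      finally show ?thesis .
    qed
    ultimately show thesis using that[OF cne iu(1)] by simp
  qed
qed

section \<open>Full weight spectrum forces one of the two forms\<close>

lemma set_add_zero_left: "A \<subseteq> carrier R \<Longrightarrow> {\<zero>} <+>\<^bsub>R\<^esub> A = A"
  unfolding set_add_def' by (auto simp: subset_iff)

text \<open>Intersections of odd dimension pass from \<open>S\<close> over \<open>F\<close> to both
  \<open>U = T + z H\<close> and \<open>T\<close> over \<open>H\<close>. The same multiplier
  \<open>m\<close> exhibits \<open>U\<close> and \<open>T\<close> as scaled spans of its powers, and
  \<open>nested_pspans\<close> aligns the two scalings.\<close>

lemma quadratic_case:
  assumes F: "subfield F R" and H: "subfield H R" and FH: "F \<subseteq> H" and d: "dim F H = 2"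
    and T: "subalgebra H T R" and T0: "T \<noteq> {\<zero>}" and S: "subalgebra F S R"
    and z: "z \<in> carrier R" "z \<notin> T" and ST: "S = T <+>\<^bsub>R\<^esub> (z <# F)"
    and att: "\<And>i. i < dim F S \<Longrightarrow> attains F S i"
  obtains c w t where "c \<in> carrier R - {\<zero>}" "w \<in> carrier R - H" "dim F S = 2 * t + 1" "1 \<le> t"
    "S = c <# (pspan H w t <+>\<^bsub>R\<^esub> (w [^] t <# F))"
    "pspan H w t \<inter> (w [^] t <# F) = {\<zero>}" "2 * t < adjoin_degree R H w"
proof -
  have Fc: "F \<subseteq> carrier R" and Hc: "H \<subseteq> carrier R" using F H subfieldE(3) by auto
  define t where "t = dim H T"
  note TF = subalgebra_restrict[OF T FH]
  have dT: "dim F T = 2 * t" unfolding t_def using dim_tower[OF F H FH T] d by simp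
  have t1: "1 \<le> t" using dim_pos[OF H T T0] t_def by simp
  have dS: "dim F S = 2 * t + 1" unfolding ST using dim_add_line[OF F TF z] dT by simp
  define U where "U = T <+>\<^bsub>R\<^esub> (z <# H)"
  have U: "subalgebra H U R" and dU: "dim F U = 2 * t + 2"
    unfolding U_def using extend_by_field_line[OF F H FH T z] dT d by simp_all
  have dHU: "dim H U = t + 1" using dim_tower[OF F H FH U] dU d by simp
  note UF = subalgebra_restrict[OF U FH]
  have TS: "T \<subseteq> S" unfolding ST
    using subset_set_add(1)[OF TF subalgebra_l_coset[OF F subfield_subalgebra[OF F subset_refl F] z(1)]] .
  have SU: "S \<subseteq> U" unfolding ST U_def by (intro set_add_mono l_coset_mono FH subset_refl)
  have sub_shift: "subalgebra E (A \<inter> (b <# A)) R" if "subfield E R" "subalgebra E A R" "b \<in> carrier R - {\<zero>}" for E A b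
    using that subalgebra_inter subalgebra_l_coset by blast
  \<comment> \<open>\<open>T \<inter> a T\<close> has even dimension over \<open>F\<close>, so an
    odd value for \<open>S\<close> excludes the first and the third outcome of
    \<open>shift_types\<close> and leaves \<open>U\<close> and \<open>T\<close> one apart.\<close>
  have odd_types: "dim H (U \<inter> (a <# U)) = i + 1 \<and> dim H (T \<inter> (a <# T)) = i"
    if a: "a \<in> carrier R - {\<zero>}" "dim F (S \<inter> (a <# S)) = 2 * i + 1" for a i
  proof -
    have "2 dvd dim F (T \<inter> (a <# T)) \<and>
      (dim F (U \<inter> (a <# U)) = dim F (T \<inter> (a <# T)) \<and> 2 * i + 1 = dim F (T \<inter> (a <# T)) \<or>
       dim F (U \<inter> (a <# U)) = dim F (T \<inter> (a <# T)) + 2 \<and> dim F (T \<inter> (a <# T)) \<le> 2 * i + 1 \<and>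
         2 * i + 1 \<le> dim F (T \<inter> (a <# T)) + 1 \<and> dim F (T \<inter> (a <# T)) + 2 * 1 \<le> 2 * i + 1 + 2 \<or>
       dim F (U \<inter> (a <# U)) = dim F (T \<inter> (a <# T)) + 2 * 2 \<and> 2 * i + 1 = dim F (T \<inter> (a <# T)) + 2 * 1)"
      using shift_types[OF F H FH T S U TS SU _ _ _ a(1), of 1] dU dT dS a(2) d by simp
    then have "dim F (T \<inter> (a <# T)) = 2 * i" "dim F (U \<inter> (a <# U)) = 2 * i + 2" by presburger+
    then show ?thesis
      using dim_tower[OF F H FH sub_shift[OF H U a(1)]] dim_tower[OF F H FH sub_shift[OF H T a(1)]] d by simp
  qed
  \<comment> \<open>The largest odd dimension below \<open>dim F S\<close>: its multiplier lowers
    both \<open>U\<close> and \<open>T\<close> by exactly one dimension over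
    \<open>H\<close>.\<close>
  have "attains F S (2 * (t - 1) + 1)" using att dS t1 by simp
  then obtain m where m: "m \<in> carrier R - {\<zero>}" "dim F (S \<inter> (m <# S)) = 2 * (t - 1) + 1"
    unfolding attains_def by blast
  have mc: "m \<in> carrier R" using m by simp
  have mU: "dim H U = Suc (dim H (U \<inter> (m <# U)))" and mT: "dim H T = Suc (dim H (T \<inter> (m <# T)))"
    using odd_types[OF m] t1 dHU t_def by auto
  obtain T' y r where T': "subalgebra (adjoin H m) T' R" "y \<in> U" "y \<notin> T'" "1 \<le> r"
    "r < adjoin_degree R H m" "U = T' <+>\<^bsub>R\<^esub> (y <# pspan H m r)" "dim H U = dim H T' + r"
    using shift_decomposition[OF H m(1) U mU] by metis
  note E = adjoin_props[OF H mc]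
  note T'H = subalgebra_restrict[OF T'(1) E(2)]
  have y: "y \<in> carrier R" using T'(2) subalgebra_in_carrier[OF U] by blast
  note psH = subalgebra_pspan[OF H mc]
  have y0: "y \<in> carrier R - {\<zero>}" using y T'(3) subalgebra_zero[OF T'H] by auto
  have "T' = {\<zero>}"
  proof (rule ccontr)
    assume T'0: "T' \<noteq> {\<zero>}"
    define V where "V = T' <+>\<^bsub>R\<^esub> (y <# adjoin H m)"
    have V: "subalgebra (adjoin H m) V R" and dV: "dim H V = dim H T' + dim H (adjoin H m)"
      unfolding V_def using extend_by_field_line[OF H E(1,2) T'(1) y T'(3)] by simp_all
    have T'U: "T' \<subseteq> U" unfolding T'(6)
      using subset_set_add(1)[OF T'H subalgebra_l_coset[OF H psH y]] .
    have UV: "U \<subseteq> V" unfolding T'(6) V_def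
      by (intro set_add_mono l_coset_mono pspan_in_adjoin[OF H mc] subset_refl)
    \<comment> \<open>Dimension \<open>i\<close> over \<open>H\<close> arises from
      \<open>2 i - 1\<close> over \<open>F\<close>, hence the restriction to positive
      \<open>i\<close>.\<close>
    have "attains H U i" if i: "1 \<le> i" "i < dim H U" for i
    proof -
      have "attains F S (2 * (i - 1) + 1)" using att dS i dHU by simp
      then obtain a where a: "a \<in> carrier R - {\<zero>}" "dim F (S \<inter> (a <# S)) = 2 * (i - 1) + 1"
        unfolding attains_def by blast
      then show ?thesis using odd_types[OF a] i unfolding attains_def by auto
    qed
    then have d2: "dim H (adjoin H m) = 2"
      using attains_imp_degree_2[OF H E(1,2) T'(1) U V T'U UV dV T'(7,4) _ T'0] T'(5)
      unfolding adjoin_degree_def by blast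
    then have "r = 1" using T'(4,5) unfolding adjoin_degree_def by simp
    then have dT': "dim H T' = t" using T'(7) dHU by simp
    note T'F = subalgebra_restrict[OF T'H FH]
    have dFT': "dim F T' = 2 * t" using dim_tower[OF F H FH T'H] d dT' by simp
    have mT': "m <# T' = T'"
      using l_coset_stable_eq[OF m(1) subalgebra_in_carrier[OF T'H] l_coset_subalgebra_subset[OF T'(1) E(3)]] .
    have T'eq: "T' = U \<inter> (m <# U)"
    proof (rule dim_subset_eq[OF H T'H sub_shift[OF H U m(1)]])
      show "T' \<subseteq> U \<inter> (m <# U)" using T'U l_coset_mono[OF T'U, of m] mT' by auto
      show "dim H (U \<inter> (m <# U)) \<le> dim H T'" using mU dHU dT' by simp
    qed
    let ?D = "S \<inter> (m <# S)"
    have D: "subalgebra F ?D R" using sub_shift[OF F S m(1)] .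
    have DT': "?D \<subseteq> T'" unfolding T'eq using SU l_coset_mono[OF SU] by blast
    note ST' = subalgebra_inter[OF S T'F]
    have dD: "dim F ?D + 1 = 2 * t" using m(2) t1 by simp
    \<comment> \<open>Otherwise \<open>T'\<close>, being stable under \<open>m\<close>, would lie in
      \<open>S \<inter> m S\<close>, which is too small. So \<open>S \<inter> m S\<close> is the
      section of \<open>T'\<close> by \<open>S\<close>.\<close>
    have "dim F (S \<inter> T') \<noteq> 2 * t"
    proof
      assume "dim F (S \<inter> T') = 2 * t"
      then have "S \<inter> T' = T'" using dim_subset_eq[OF F ST' T'F Int_lower2] dFT' by simp
      then have "T' \<subseteq> S" by blast
      then have "T' \<subseteq> ?D" using l_coset_mono[of T' S m] mT' by auto
      then show False using dim_mono[OF F T'F D] dD dFT' by simp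
    qed
    then have dST': "dim F (S \<inter> T') \<le> dim F ?D"
      using dim_mono[OF F ST' T'F Int_lower2] dFT' dD by simp
    have DS: "?D = S \<inter> T'" using DT' by (intro dim_subset_eq[OF F D ST' _ dST']) auto
    \<comment> \<open>\<open>?D\<close> lies in both \<open>m S\<close> and \<open>T'\<close>, hence
      in \<open>m ?D\<close>; equal dimensions make it stable under \<open>m\<close>.\<close>
    have "m <# ?D = (m <# S) \<inter> T'"
      unfolding DS using l_coset_Int[OF m(1) subalgebra_in_carrier[OF S] subalgebra_in_carrier[OF T'F]] mT' by simp
    then have "?D \<subseteq> m <# ?D" using DT' by blast
    then have "?D = m <# ?D"
      using dim_subset_eq[OF F D subalgebra_l_coset[OF F D mc]] dim_l_coset_subalgebra[OF F D m(1)] by simp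
    then have DE: "subalgebra (adjoin F m) ?D R" using subalgebra_adjoin[OF F D mc] by simp
    have T'E: "subalgebra (adjoin F m) T' R" using subalgebra_adjoin[OF F T'F mc] mT' by simp
    note EF = adjoin_props[OF F mc]
    \<comment> \<open>The dimensions are the consecutive numbers 2t - 1 and 2t.\<close>
    have "dim F (adjoin F m) dvd dim F ?D" "dim F (adjoin F m) dvd dim F ?D + 1"
      using dim_subfield_dvd[OF F EF(1,2)] DE T'E dFT' dD by metis+
    then have "adjoin_degree R F m = 1" unfolding adjoin_degree_def by (metis dvd_add_right_iff nat_dvd_1_iff_1)
    then have "m \<in> F" using adjoin_degree_eq_1D[OF F mc] by simp
    then have "m <# S = S"
      using l_coset_stable_eq[OF m(1) subalgebra_in_carrier[OF S] l_coset_subalgebra_subset[OF S]] by simp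
    then show False using m(2) dS t1 by simp
  qed
  then have Ueq: "U = y <# pspan H m (Suc t)" and r: "Suc t < adjoin_degree R H m"
    using T'(5-7) set_add_zero_left[OF l_coset_in_carrier[OF y subalgebra_in_carrier[OF psH]]] dim_zero[OF H] dHU by auto
  obtain T2 x r2 where T2: "subalgebra (adjoin H m) T2 R" "x \<in> T" "x \<notin> T2" "1 \<le> r2"
    "r2 < adjoin_degree R H m" "T = T2 <+>\<^bsub>R\<^esub> (x <# pspan H m r2)" "dim H T = dim H T2 + r2"
    using shift_decomposition[OF H m(1) T mT] by metis
  note T2H = subalgebra_restrict[OF T2(1) E(2)]
  have x: "x \<in> carrier R" using T2(2) subalgebra_in_carrier[OF T] by blast
  have x0: "x \<in> carrier R - {\<zero>}" using x T2(3) subalgebra_zero[OF T2H] by auto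
  \<comment> \<open>A nonzero space over \<open>H(m)\<close> has dimension at least the degree of
    \<open>m\<close> over \<open>H\<close>, which already exceeds \<open>t + 1\<close>, while
    \<open>T\<close> has dimension \<open>t\<close>.\<close>
  have "T2 = {\<zero>}"
  proof (rule ccontr)
    assume "T2 \<noteq> {\<zero>}"
    then have "dim H (adjoin H m) \<le> dim H T2"
      using dim_subfield_dvd[OF H E(1,2) T2(1)] dim_pos[OF H T2H] by (intro dvd_imp_le) auto
    then show False using T2(7) r t_def unfolding adjoin_degree_def by simp
  qed
  then have Teq: "T = x <# pspan H m t"
    using T2(6,7) set_add_zero_left[OF l_coset_in_carrier[OF x subalgebra_in_carrier[OF psH]]] dim_zero[OF H] t_def by auto
  obtain c w where cw: "c \<in> carrier R - {\<zero>}" "w \<in> carrier R" "T = c <# pspan H w t" "U = c <# pspan H w (Suc t)"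
  proof (rule nested_pspans[OF H mc t1 r y0 x0])
    show "x <# pspan H m t \<subseteq> y <# pspan H m (Suc t)"
      using TS SU Teq Ueq by auto
  qed (use that Teq Ueq in auto)
  have cc: "c \<in> carrier R" using cw by simp
  note pw = subalgebra_pspan[OF H cw(2)]
  have dw: "dim H (pspan H w t) = t" "dim H (pspan H w (Suc t)) = Suc t"
    using dim_l_coset_subalgebra[OF H pw cw(1)] arg_cong[OF cw(3), of "dim H"] arg_cong[OF cw(4), of "dim H"] dHU t_def
    by simp_all
  have wH: "w \<notin> H"
  proof
    assume "w \<in> H"
    then have "pspan H w (Suc t) \<subseteq> H"
      using pspan_in_adjoin[OF H cw(2)] adjoin_minimal[OF H subset_refl] by blast
    then have "Suc t \<le> 1"
      using dim_mono[OF H pw subfield_subalgebra[OF H subset_refl H]] dim_self[OF H] dw by metis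
    then show False using t1 by simp
  qed
  then have w0: "w \<in> carrier R - {\<zero>}" using cw subringE(2)[OF subfieldE(1)[OF H]] by auto
  have wt: "w [^] t \<in> carrier R - {\<zero>}"
    using w0 by (induction t) (auto simp: integral_iff)
  have "U = T <+>\<^bsub>R\<^esub> (c <# (w [^] t <# H))"
    unfolding cw(3,4) pspan_Suc(1)[OF H cw(2)]
    using l_coset_set_add[OF cc subalgebra_in_carrier[OF pw] l_coset_in_carrier[OF _ Hc]] wt by simp
  moreover have "z \<in> U"
    using SU subset_set_add(2)[OF TF subalgebra_l_coset[OF F subfield_subalgebra[OF F subset_refl F] z(1)]]
      mem_l_coset[OF subfield_one[OF F], of z] z ST by auto
  ultimately have "z \<in> T <+>\<^bsub>R\<^esub> (c <# (w [^] t <# H))" by simp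
  then obtain u v where uv: "u \<in> T" "v \<in> c <# (w [^] t <# H)" "z = u \<oplus> v"
    unfolding set_add_mem_iff by blast
  then obtain h where h: "h \<in> H" "v = c \<otimes> (w [^] t \<otimes> h)"
    by (metis l_coset_mem_iff)
  have hc: "h \<in> carrier R" using h Hc by blast
  have uc: "u \<in> carrier R" using uv subalgebra_in_carrier[OF T] by blast
  have vc: "v \<in> carrier R" using h hc wt cc by simp
  have h0: "h \<noteq> \<zero>"
  proof
    assume "h = \<zero>"
    then have "z = u" using uv h wt cc uc by simp
    then show False using uv z by simp
  qed
  \<comment> \<open>Multiplication by \<open>h \<in> H\<close> fixes the \<open>H\<close>-space
    \<open>pspan H w t\<close>, so \<open>h\<close> can be absorbed into the scalar; the line
    \<open>v F\<close> becomes \<open>?c w ^ t F\<close>.\<close>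
  let ?c = "c \<otimes> h"
  have c'0: "?c \<in> carrier R - {\<zero>}" using cw(1) h0 hc by (auto simp: integral_iff)
  have c'c: "?c \<in> carrier R" using c'0 by simp
  let ?B = "pspan H w t" and ?L = "w [^] t <# F"
  have L: "subalgebra F ?L R" using subalgebra_l_coset[OF F subfield_subalgebra[OF F subset_refl F]] wt by simp
  note Lc = subalgebra_in_carrier[OF L] and Bc = subalgebra_in_carrier[OF pw[of t]]
  note BF = subalgebra_restrict[OF pw[of t] FH]
  have SB: "S = ?c <# (?B <+>\<^bsub>R\<^esub> ?L)"
  proof -
    have "h <# ?B = ?B"
      using l_coset_stable_eq[OF _ Bc l_coset_subalgebra_subset[OF pw h(1)]] hc h0 by simp
    then have TB: "?c <# ?B = T" using l_coset_mult[OF cc hc Bc] cw(3) by simp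
    have "?c <# ?L = v <# F"
      using l_coset_mult[OF c'c _ Fc] wt h cc hc by (simp add: m_ac)
    then have eq: "?c <# (?B <+>\<^bsub>R\<^esub> ?L) = T <+>\<^bsub>R\<^esub> (v <# F)"
      using l_coset_set_add[OF c'c Bc Lc] TB by simp
    have vT: "v \<notin> T"
    proof
      assume "v \<in> T"
      then show False using uv subalgebra_add[OF T] z by blast
    qed
    have "v \<in> S"
    proof -
      have "z \<in> S" "u \<in> S" using uv TS subset_set_add(2)[OF TF subalgebra_l_coset[OF F subfield_subalgebra[OF F subset_refl F] z(1)]]
        mem_l_coset[OF subfield_one[OF F], of z] z ST by auto
      then have "z \<ominus> u \<in> S" using subalgebra_minus[OF S] by blast
      moreover have "z \<ominus> u = v" using uv(3) uc vc a_comm[OF uc vc] by (simp add: minus_eq a_assoc r_neg)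
      ultimately show ?thesis by simp
    qed
    then show ?thesis using add_line_eq[OF F TF S TS _ vT] dS dT eq by simp
  qed
  have "dim F (?B <+>\<^bsub>R\<^esub> ?L) = 2 * t + 1"
    using dim_l_coset_subalgebra[OF F subalgebra_set_add[OF F BF L] c'0] SB dS by simp
  moreover have "dim F ?B = 2 * t" using dim_tower[OF F H FH pw] d dw by simp
  moreover have "dim F ?L = 1"
    using dim_l_coset_subalgebra[OF F subfield_subalgebra[OF F subset_refl F] wt] dim_self[OF F] by simp
  ultimately have "dim F (?B \<inter> ?L) = 0" using dim_set_add[OF F BF L] by simp
  then have BL: "?B \<inter> ?L = {\<zero>}" using dim_eq_0_iff[OF F subalgebra_inter[OF BF L]] by simp
  have "2 * t < adjoin_degree R H w"
  proof -
    note Ew = adjoin_props[OF H cw(2)]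
    have FE: "F \<subseteq> adjoin H w" using FH Ew(2) by blast
    have wtE: "w [^] t \<in> adjoin H w"
      using power_in_pspan[OF H cw(2), of t "Suc t"] pspan_in_adjoin[OF H cw(2)] by blast
    have "?L \<subseteq> adjoin H w"
      using line_subset[OF F subfield_subalgebra[OF F FE Ew(1)] wtE] .
    then have sub: "?B <+>\<^bsub>R\<^esub> ?L \<subseteq> adjoin H w"
      using set_add_subset[OF Ew(4) pspan_in_adjoin[OF H cw(2)]] by simp
    have "attains F (?B <+>\<^bsub>R\<^esub> ?L) 1"
      using att[of 1] dS t1 SB attains_l_coset[OF F subalgebra_in_carrier[OF subalgebra_set_add[OF F BF L]] c'0] by simp
    then have "2 * (2 * t + 1) \<le> dim F (adjoin H w) + 1"
      using attains_1_bound[OF F Ew(1) FE subalgebra_set_add[OF F BF L] sub] \<open>dim F (?B <+>\<^bsub>R\<^esub> ?L) = 2 * t + 1\<close> by simp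
    moreover have "dim F (adjoin H w) = 2 * adjoin_degree R H w"
      unfolding adjoin_degree_def using dim_tower[OF F H FH Ew(4)] d by simp
    \<comment> \<open>The bound reads 4t + 2 \<le> 2e + 1 with e the degree of \<open>w\<close> over
      \<open>H\<close>; parity sharpens it to 2t + 1 \<le> e.\<close>
    ultimately show ?thesis by presburger
  qed
  then show thesis using that[OF c'0 _ dS t1 SB BL] cw(2) wH by simp
qed

lemma attains_all_imp_form:
  assumes F: "subfield F R" and S: "subalgebra F S R" and k: "1 \<le> dim F S"
    and att: "\<And>i. i < dim F S \<Longrightarrow> attains F S i"
  obtains (chain) c x where "c \<in> carrier R - {\<zero>}" "x \<in> carrier R - F" "S = c <# pspan F x (dim F S)"
      "2 * dim F S \<le> adjoin_degree R F x + 1" "2 * dim F S \<le> dim F (carrier R)"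
    | (quadratic) H c w t where "subfield H R" "F \<subseteq> H" "dim F H = 2" "c \<in> carrier R - {\<zero>}"
      "w \<in> carrier R - H" "dim F S = 2 * t + 1" "S = c <# (pspan H w t <+>\<^bsub>R\<^esub> (w [^] t <# F))"
      "pspan H w t \<inter> (w [^] t <# F) = {\<zero>}" "2 * t < adjoin_degree R H w"
proof -
  have "attains F S (dim F S - 1)" using att k by simp
  then obtain x where x: "x \<in> carrier R - {\<zero>}" "dim F (S \<inter> (x <# S)) = dim F S - 1"
    unfolding attains_def by blast
  have xc: "x \<in> carrier R" using x by simp
  have "dim F S = Suc (dim F (S \<inter> (x <# S)))" using x k by simp
  then obtain T y r where T: "subalgebra (adjoin F x) T R" "y \<in> S" "y \<notin> T" "1 \<le> r"
    "r < adjoin_degree R F x" "S = T <+>\<^bsub>R\<^esub> (y <# pspan F x r)" "dim F S = dim F T + r"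
    using shift_decomposition[OF F x(1) S] by metis
  note E = adjoin_props[OF F xc]
  note TF = subalgebra_restrict[OF T(1) E(2)]
  note ps = subalgebra_pspan[OF F xc]
  have y: "y \<in> carrier R" using T(2) subalgebra_in_carrier[OF S] by blast
  have y0: "y \<in> carrier R - {\<zero>}" using y T(3) subalgebra_zero[OF TF] by auto
  show thesis
  proof (cases "T = {\<zero>}")
    case True
    have Sr: "S = y <# pspan F x r" "dim F S = r"
      using T(6,7) True dim_zero[OF F] set_add_zero_left[OF l_coset_in_carrier[OF y subalgebra_in_carrier[OF ps]]] by auto
    have "x \<notin> F"
    proof
      assume "x \<in> F"
      then have "adjoin F x \<subseteq> F" using adjoin_minimal[OF F subset_refl] by blast
      then have "adjoin_degree R F x \<le> 1"
        unfolding adjoin_degree_def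
        using dim_mono[OF F E(4) subfield_subalgebra[OF F subset_refl F]] dim_self[OF F] by metis
      then show False using T(4,5) by simp
    qed
    moreover have "2 * dim F S \<le> adjoin_degree R F x + 1"
    \<comment> \<open>For \<open>r = 1\<close> dimension 1 is that of \<open>S\<close> itself and
      gives no information; the bound then follows from \<open>r\<close> being below the
      degree.\<close>
    proof (cases "r = 1")
      case True
      then show ?thesis using T(4,5) Sr by simp
    next
      case False
      then have "attains F S 1" using att T(4) Sr by simp
      then have "attains F (pspan F x r) 1" using attains_l_coset[OF F subalgebra_in_carrier[OF ps] y0] Sr by simp
      then show ?thesis
        using attains_1_bound[OF F E(1,2) ps pspan_in_adjoin[OF F xc], of r] Sr
          dim_l_coset_subalgebra[OF F ps y0, of r]
        unfolding adjoin_degree_def by simp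
    qed
    moreover have "2 * dim F S \<le> dim F (carrier R)" using attains_0_bound[OF F S] att k by simp
    ultimately show thesis using chain[OF y0] xc Sr by simp
  next
    case False
    define V where "V = T <+>\<^bsub>R\<^esub> (y <# adjoin F x)"
    have V: "subalgebra (adjoin F x) V R" and dV: "dim F V = dim F T + dim F (adjoin F x)"
      unfolding V_def using extend_by_field_line[OF F E(1,2) T(1) y T(3)] by simp_all
    have TS: "T \<subseteq> S" unfolding T(6)
      using subset_set_add(1)[OF TF subalgebra_l_coset[OF F ps y]] .
    have SV: "S \<subseteq> V" unfolding T(6) V_def
      by (intro set_add_mono l_coset_mono pspan_in_adjoin[OF F xc] subset_refl)
    have d2: "dim F (adjoin F x) = 2"
      using attains_imp_degree_2[OF F E(1,2) T(1) S V TS SV dV T(7,4) _ False att] T(5)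
      unfolding adjoin_degree_def by blast
    then have "r = 1" using T(4,5) unfolding adjoin_degree_def by simp
    then have ST: "S = T <+>\<^bsub>R\<^esub> (y <# F)" using T(6) pspan_1[OF F xc] by simp
    show thesis
      using quadratic_case[OF F E(1,2) d2 T(1) False S y T(3) ST att] quadratic[OF E(1,2) d2] by metis
  qed
qed

section \<open>The two forms have full weight spectrum\<close>

lemma power_nonzero: "x \<in> carrier R - {\<zero>} \<Longrightarrow> x [^] (i::nat) \<in> carrier R - {\<zero>}"
  by (induction i) (auto simp: integral_iff)

lemma chain_attains:
  assumes F: "subfield F R" and x: "x \<in> carrier R - F"
    and k: "dim F (pspan F x k) = k" "1 \<le> k"
    and deg: "2 * k \<le> adjoin_degree R F x \<or>
      2 * k \<le> adjoin_degree R F x + 1 \<and> adjoin_degree R F x < dim F (carrier R)"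
    and i: "i < k"
  shows "attains F (pspan F x k) i"
proof -
  have xc: "x \<in> carrier R" using x by simp
  have x0: "x \<in> carrier R - {\<zero>}" using x subringE(2)[OF subfieldE(1)[OF F]] by auto
  note ps = subalgebra_pspan[OF F xc]
  let ?P = "pspan F x k"
  show ?thesis
  \<comment> \<open>With j = k - i, the sum of \<open>?P\<close> and \<open>x ^ j ?P\<close> is the
    span of k + j powers, of full dimension while k + j is at most the degree. The exception is i =
    0 with 2k one above the degree; then a multiplier outside \<open>F(x)\<close> exists and makes
    the intersection zero.\<close>
  proof (cases "k + (k - i) \<le> adjoin_degree R F x")
    case True
    define j where "j = k - i"
    have j: "j \<le> k" "k + j \<le> adjoin_degree R F x" "i = k - j" unfolding j_def using True i by auto
    note xj = power_nonzero[OF x0, of j]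
    have xPs: "subalgebra F (x [^] j <# ?P) R" using subalgebra_l_coset[OF F ps[of k]] xj by simp
    have "?P <+>\<^bsub>R\<^esub> (x [^] j <# ?P) = pspan F x (k + j)"
    proof
      show "?P <+>\<^bsub>R\<^esub> (x [^] j <# ?P) \<subseteq> pspan F x (k + j)"
        using set_add_subset[OF ps pspan_mono[OF F xc, of k "k + j"] power_l_coset_pspan_subset[OF F xc, of j k, unfolded add.commute[of j k]]]
        by simp
      show "pspan F x (k + j) \<subseteq> ?P <+>\<^bsub>R\<^esub> (x [^] j <# ?P)"
        unfolding add.commute[of k j] pspan_add[OF F xc, of j k]
        by (rule set_add_mono[OF pspan_mono[OF F xc j(1)] subset_refl])
    qed
    then have "dim F (?P \<inter> (x [^] j <# ?P)) = k - j"
      using dim_set_add[OF F ps[of k] xPs] dim_l_coset_subalgebra[OF F ps[of k] xj] k(1) dim_pspan[OF F xc j(2)] by simp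
    then show ?thesis using j(3) xj unfolding attains_def by blast
  next
    case False
    then have i0: "i = 0" and lt: "adjoin_degree R F x < dim F (carrier R)" using deg i by auto
    note E = adjoin_props[OF F xc]
    have "adjoin F x \<noteq> carrier R" using lt unfolding adjoin_degree_def by auto
    then obtain a where a: "a \<in> carrier R" "a \<notin> adjoin F x"
      using subfieldE(3)[OF E(1)] by blast
    have a0: "a \<in> carrier R - {\<zero>}" using a subringE(2)[OF subfieldE(1)[OF E(1)]] by auto
    have "?P \<inter> (a <# ?P) \<subseteq> adjoin F x \<inter> (a <# adjoin F x)"
      using pspan_in_adjoin[OF F xc] l_coset_mono[OF pspan_in_adjoin[OF F xc]] by blast
    then have "?P \<inter> (a <# ?P) = {\<zero>}"
      using subfield_Int_l_coset[OF E(1) a] subalgebra_zero[OF ps[of k]]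
        subalgebra_zero[OF subalgebra_l_coset[OF F ps[of k] a(1)]] by auto
    then have "dim F (?P \<inter> (a <# ?P)) = i" using i0 dim_zero[OF F] by simp
    then show ?thesis using a0 unfolding attains_def by blast
  qed
qed

text \<open>Multiplication by \<open>x\<^sup>j\<close> gives the odd dimensions, multiplication by \<open>b x\<^sup>j / (x\<^sup>j + 1)\<close>
  with \<open>b \<in> H - F\<close> the even ones.\<close>

lemma quadratic_attains:
  assumes F: "subfield F R" and H: "subfield H R" and FH: "F \<subseteq> H" and d: "dim F H = 2"
    and x: "x \<in> carrier R - H" and l: "2 * l < adjoin_degree R H x"
    and i: "i < 2 * l + 1"
  defines "S \<equiv> pspan H x l <+>\<^bsub>R\<^esub> (x [^] l <# F)"
  shows "attains F S i"
proof -
  have xc: "x \<in> carrier R" using x by simp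
  have x0: "x \<in> carrier R - {\<zero>}" using x subringE(2)[OF subfieldE(1)[OF H]] by auto
  have Fc: "F \<subseteq> carrier R" and Hc: "H \<subseteq> carrier R" using F H subfieldE(3) by auto
  let ?P = "pspan H x" and ?L = "\<lambda>j. x [^] (j::nat) <# F"
  note ps = subalgebra_pspan[OF H xc]
  note psF = subalgebra_restrict[OF ps FH]
  note xp = power_nonzero[OF x0]
  have xpc: "x [^] (j::nat) \<in> carrier R" for j using xc by simp
  have L: "subalgebra F (?L j) R" for j
    using subalgebra_l_coset[OF F subfield_subalgebra[OF F subset_refl F] xpc] .
  have Lc: "?L j \<subseteq> carrier R" and Pc: "?P j \<subseteq> carrier R" for j
    using subalgebra_in_carrier[OF L] subalgebra_in_carrier[OF ps] .
  have S: "subalgebra F S R" unfolding S_def using subalgebra_set_add[OF F psF L] .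
  note Sc = subalgebra_in_carrier[OF S]
  have dP: "dim F (?P j) = 2 * j" if "j \<le> adjoin_degree R H x" for j
    using dim_tower[OF F H FH ps] d dim_pspan[OF H xc that] by simp
  have xnot: "x [^] j \<notin> ?P j" if "j < adjoin_degree R H x" for j
  proof
    assume "x [^] j \<in> ?P j"
    then have "?P (Suc j) \<subseteq> ?P j"
      unfolding pspan_Suc(1)[OF H xc] by (intro set_add_subset[OF ps] line_subset[OF H ps] subset_refl)
    then show False using dim_mono[OF F psF psF, of "Suc j" j] dP[of j] dP[of "Suc j"] that by simp
  qed
  have dPL: "dim F (?P j <+>\<^bsub>R\<^esub> ?L j) = 2 * j + 1" if "j < adjoin_degree R H x" for j
    using dim_add_line[OF F psF xpc xnot[OF that]] dP[of j] that by simp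
  have dS: "dim F S = 2 * l + 1" unfolding S_def using dPL l by simp
  have PS: "?P l \<subseteq> S" "?L l \<subseteq> S" unfolding S_def using subset_set_add[OF psF L] by auto
  have xlS: "x [^] l \<in> S"
    using PS(2) mem_l_coset[OF subfield_one[OF F], of "x [^] l"] xpc by auto
  have SP: "S \<subseteq> ?P (Suc l)"
    unfolding S_def pspan_Suc(1)[OF H xc] by (intro set_add_mono l_coset_mono FH subset_refl)
  show ?thesis
  proof (cases "odd i")
    case True
    then obtain i' where i': "i = 2 * i' + 1" by (elim oddE)
    define j where "j = l - i'"
    have j: "1 \<le> j" "j \<le> l" "i = 2 * (l - j) + 1" unfolding j_def using i' i by auto
    note xS = subalgebra_l_coset[OF F S xpc[of j]]
    \<comment> \<open>The sum has the shape of \<open>S\<close> with \<open>l + j\<close> in place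
      of \<open>l\<close>. As \<open>l + j \<le> 2 l\<close> is below the degree, its dimension is
      2(l + j) + 1.\<close>
    have "S <+>\<^bsub>R\<^esub> (x [^] j <# S) = ?P (l + j) <+>\<^bsub>R\<^esub> ?L (l + j)"
    proof
      let ?Z = "?P (l + j) <+>\<^bsub>R\<^esub> ?L (l + j)"
      note Z = subalgebra_set_add[OF F psF[of "l + j"] L[of "l + j"]]
      note PZ = subset_set_add[OF psF[of "l + j"] L[of "l + j"]]
      have xjL: "x [^] j <# ?L l = ?L (l + j)"
        using l_coset_mult[OF xpc xpc Fc] nat_pow_mult[OF xc] by (simp add: add.commute)
      have "?L l \<subseteq> ?P (l + j)"
        using line_subset[OF F psF power_in_pspan[OF H xc]] j by simp
      then have "S \<subseteq> ?Z"
        unfolding S_def using PZ(1) pspan_mono[OF H xc, of l "l + j"] by (intro set_add_subset[OF Z]) auto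
      moreover have "x [^] j <# S \<subseteq> ?Z"
        unfolding S_def l_coset_set_add[OF xpc Pc Lc] xjL
        using power_l_coset_pspan_subset[OF H xc, of j l] by (intro set_add_mono) (auto simp: add.commute)
      ultimately show "S <+>\<^bsub>R\<^esub> (x [^] j <# S) \<subseteq> ?Z" by (rule set_add_subset[OF Z])
      note W = subalgebra_set_add[OF F S xS]
      note SW = subset_set_add[OF S xS]
      have "?P (l + j) \<subseteq> S <+>\<^bsub>R\<^esub> (x [^] j <# S)"
        unfolding add.commute[of l j] pspan_add[OF H xc, of j l]
        using pspan_mono[OF H xc j(2)] PS(1) by (intro set_add_mono l_coset_mono) auto
      moreover have "?L (l + j) \<subseteq> S <+>\<^bsub>R\<^esub> (x [^] j <# S)"
        using SW(2) l_coset_mono[OF PS(2), of "x [^] j"] unfolding xjL by blast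
      ultimately show "?Z \<subseteq> S <+>\<^bsub>R\<^esub> (x [^] j <# S)" by (rule set_add_subset[OF W])
    qed
    then have "dim F (S \<inter> (x [^] j <# S)) = 2 * (l - j) + 1"
      using dim_set_add[OF F S xS] dim_l_coset_subalgebra[OF F S xp] dS dPL[of "l + j"] j l by simp
    then show ?thesis using j(3) xp unfolding attains_def by blast
  next
    case False
    then obtain i' where i': "i = 2 * i'" by auto
    define j where "j = l - i'"
    have j: "j \<le> l" "i = 2 * (l - j)" unfolding j_def using i' i by auto
    have "F \<noteq> H" using d dim_self[OF F] by auto
    then obtain b where b: "b \<in> H" "b \<notin> F" using FH by blast
    have bc: "b \<in> carrier R" using b Hc by blast
    have b0: "b \<in> carrier R - {\<zero>}" using b bc subringE(2)[OF subfieldE(1)[OF F]] by auto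
    note ib = inv_props[OF b0]
    have ibH: "inv b \<in> H" using subfield_m_inv(1)[OF H] b b0 by auto
    show ?thesis
    \<comment> \<open>For j = 0 the denominator \<open>x ^ j + 1\<close> vanishes in characteristic
      two, so dimension 2l uses the multiplier \<open>b\<close> itself. \<open>S\<close> and
      \<open>b S\<close> lie in a space of dimension 2l + 2, and \<open>S\<close> has odd dimension,
      so it cannot be stable under the quadratic element \<open>b\<close>.\<close>
    proof (cases "j = 0")
      case True
      note bS = subalgebra_l_coset[OF F S bc]
      have "b <# S \<subseteq> ?P (Suc l)"
        using l_coset_mono[OF SP, of b] l_coset_subalgebra_subset[OF ps b(1), of "Suc l"] by blast
      then have "2 * (2 * l + 1) \<le> 2 * Suc l + dim F (S \<inter> (b <# S))"
        using dim_Int_ge[OF F S bS psF SP] dim_l_coset_subalgebra[OF F S b0] dS dP[of "Suc l"] l by simp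
      moreover have "dim F (S \<inter> (b <# S)) \<le> 2 * l + 1"
        using dim_mono[OF F subalgebra_inter[OF S bS] S Int_lower1] dS by simp
      moreover have "dim F (S \<inter> (b <# S)) \<noteq> 2 * l + 1"
      proof
        assume as: "dim F (S \<inter> (b <# S)) = 2 * l + 1"
        then have "S \<inter> (b <# S) = b <# S"
          using dim_subset_eq[OF F subalgebra_inter[OF S bS] bS Int_lower2] dim_l_coset_subalgebra[OF F S b0] dS by simp
        then have "b <# S \<subseteq> S" by blast
        then have Sb: "subalgebra (adjoin F b) S R" using subalgebra_adjoin[OF F S bc] by simp
        note E = adjoin_props[OF F bc]
        have "adjoin F b \<subseteq> H" using adjoin_minimal[OF H FH b(1)] .
        then have "dim F (adjoin F b) \<le> 2" using dim_mono[OF F E(4) subfield_subalgebra[OF F FH H]] d by simp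
        moreover have "dim F (adjoin F b) dvd 2 * l + 1" using dim_subfield_dvd[OF F E(1,2) Sb] dS by simp
        then have "dim F (adjoin F b) \<noteq> 2" "dim F (adjoin F b) \<noteq> 0"
          by (force, intro notI, simp)
        ultimately have "adjoin_degree R F b = 1" unfolding adjoin_degree_def by linarith
        then show False using adjoin_degree_eq_1D[OF F bc] b by simp
      qed
      ultimately have "dim F (S \<inter> (b <# S)) = i" using j True by simp
      then show ?thesis using b0 unfolding attains_def by blast
    next
      case False
      \<comment> \<open>Denominators are cleared: the multiplier is \<open>?g / ?h\<close>, and
        \<open>?h S \<inter> ?g S\<close> is \<open>?h\<close> times the intersection in
        question.\<close>
      let ?h = "x [^] j \<oplus> \<one>" and ?g = "x [^] j \<otimes> b"
      have hc: "?h \<in> carrier R" and gc: "?g \<in> carrier R" using xpc bc by auto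
      have g0: "?g \<in> carrier R - {\<zero>}" using b0 xp[of j] by (auto simp: integral_iff)
      note hS = subalgebra_l_coset[OF F S hc] and gS = subalgebra_l_coset[OF F S gc]
      let ?Z = "(?h <# S) <+>\<^bsub>R\<^esub> (?g <# S)"
      have Z: "subalgebra F ?Z R" using subalgebra_set_add[OF F hS gS] .
      have hZ: "?h <# S \<subseteq> ?Z" and gZ: "?g <# S \<subseteq> ?Z" using subset_set_add[OF hS gS] by auto
      \<comment> \<open>For \<open>p \<in> ?P l\<close>, \<open>x ^ j p\<close> is \<open>?g\<close>
        applied to \<open>p / b\<close>, and the summand \<open>\<one>\<close> of \<open>?h\<close>
        then recovers \<open>p\<close> itself. Applying \<open>?h\<close> and \<open>?g\<close> to
        \<open>x ^ l\<close> yields \<open>x ^ (l + j)\<close> and its multiple by \<open>b\<close>,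
        which fill the top line over \<open>H\<close>.\<close>
      have "?Z = ?P (Suc (l + j))"
      proof
        let ?Q = "?P (Suc (l + j))"
        have SQ: "S \<subseteq> ?Q" using SP pspan_mono[OF H xc, of "Suc l" "Suc (l + j)"] by auto
        have xQ: "x [^] j \<otimes> s \<in> ?Q" if "s \<in> ?P (Suc l)" for s
          using mem_l_coset[OF that, of "x [^] j"] power_l_coset_pspan_subset[OF H xc, of j "Suc l"]
          by (auto simp: add.commute)
        have "?h <# S \<subseteq> ?Q"
        proof
          fix u assume "u \<in> ?h <# S"
          then obtain s where s: "s \<in> S" "u = ?h \<otimes> s" unfolding l_coset_mem_iff by blast
          have "u = x [^] j \<otimes> s \<oplus> s" using s Sc xpc by (auto simp: l_distr)
          then show "u \<in> ?Q" using subalgebra_add[OF ps xQ] s SP SQ by auto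
        qed
        moreover have "?g <# S \<subseteq> ?Q"
        proof
          fix u assume "u \<in> ?g <# S"
          then obtain s where s: "s \<in> S" "u = ?g \<otimes> s" unfolding l_coset_mem_iff by blast
          have sc: "s \<in> carrier R" using s Sc by auto
          have "b \<otimes> s \<in> ?P (Suc l)" using subalgebra.smult_closed[OF ps b(1)] s SP by blast
          then show "u \<in> ?Q" using xQ[of "b \<otimes> s"] s sc xpc bc by (simp add: m_assoc)
        qed
        ultimately show "?Z \<subseteq> ?Q" by (rule set_add_subset[OF psF])
        have xPZ: "x [^] j \<otimes> p \<in> ?Z" if p: "p \<in> ?P l" for p
        proof -
          have pc: "p \<in> carrier R" using p Pc by blast
          have "inv b \<otimes> p \<in> S" using subalgebra.smult_closed[OF ps ibH p] PS(1) by blast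
          then have "?g \<otimes> (inv b \<otimes> p) \<in> ?Z" using mem_l_coset[of _ S ?g] gZ by blast
          moreover have "?g \<otimes> (inv b \<otimes> p) = x [^] j \<otimes> ((b \<otimes> inv b) \<otimes> p)"
            using xpc bc ib(1) pc by (simp add: m_assoc)
          ultimately show ?thesis using ib(3) pc by simp
        qed
        have PZ: "?P l \<subseteq> ?Z"
        proof
          fix p assume p: "p \<in> ?P l"
          have pc: "p \<in> carrier R" using p Pc by blast
          have "?h \<otimes> p \<in> ?Z" using mem_l_coset[of p S ?h] p PS(1) hZ by blast
          then have "?h \<otimes> p \<ominus> x [^] j \<otimes> p \<in> ?Z" using subalgebra_minus[OF Z _ xPZ[OF p]] by blast
          moreover have "?h \<otimes> p \<ominus> x [^] j \<otimes> p = p"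
            using pc xpc by (simp add: l_distr minus_eq a_ac r_neg r_neg1 r_neg2)
          ultimately show "p \<in> ?Z" by simp
        qed
        have "?P (l + j) \<subseteq> ?Z"
          unfolding add.commute[of l j] pspan_add[OF H xc, of j l]
        proof (rule set_add_subset[OF Z])
          show "?P j \<subseteq> ?Z" using PZ pspan_mono[OF H xc j(1)] by blast
          show "x [^] j <# ?P l \<subseteq> ?Z" using xPZ by (auto simp: l_coset_mem_iff)
        qed
        moreover have "x [^] (l + j) <# H \<subseteq> ?Z"
        proof -
          have xlZ: "x [^] l \<in> ?Z"
            using \<open>?P (l + j) \<subseteq> ?Z\<close> power_in_pspan[OF H xc, of l "l + j"] False by auto
          have "?h \<otimes> x [^] l \<in> ?Z" using mem_l_coset[OF xlS, of ?h] hZ by blast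
          then have "?h \<otimes> x [^] l \<ominus> x [^] l \<in> ?Z" using subalgebra_minus[OF Z _ xlZ] by blast
          moreover have "?h \<otimes> x [^] l \<ominus> x [^] l = x [^] (l + j)"
            using xpc nat_pow_mult[OF xc, of j l] by (simp add: l_distr minus_eq a_assoc r_neg add.commute)
          ultimately have 1: "x [^] (l + j) \<in> ?Z" by simp
          have "?g \<otimes> x [^] l \<in> ?Z" using mem_l_coset[OF xlS, of ?g] gZ by blast
          moreover have "?g \<otimes> x [^] l = x [^] (l + j) \<otimes> b"
            using xpc bc nat_pow_mult[OF xc, of l j] m_ac(3)[of "x [^] j"] by (simp add: m_ac)
          ultimately have 2: "x [^] (l + j) \<otimes> b \<in> ?Z" by simp
          have "H = F <+>\<^bsub>R\<^esub> (b <# F)"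
            using add_line_eq[OF F subfield_subalgebra[OF F subset_refl F] subfield_subalgebra[OF F FH H] FH b]
              dim_self[OF F] d by simp
          then have "x [^] (l + j) <# H = ?L (l + j) <+>\<^bsub>R\<^esub> ((x [^] (l + j) \<otimes> b) <# F)"
            using l_coset_set_add[OF xpc Fc l_coset_in_carrier[OF bc Fc]] l_coset_mult[OF xpc bc Fc] by simp
          then show ?thesis using set_add_subset[OF Z line_subset[OF F Z 1] line_subset[OF F Z 2]] by simp
        qed
        ultimately show "?Q \<subseteq> ?Z"
          unfolding pspan_Suc(1)[OF H xc] by (rule set_add_subset[OF Z])
      qed
      then have dZ: "dim F ?Z = 2 * Suc (l + j)" using dP[of "Suc (l + j)"] j l by simp
      note sum = dim_set_add[OF F hS gS, unfolded dZ dim_l_coset_subalgebra[OF F S g0] dS]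
      \<comment> \<open>With \<open>?h\<close> zero, the sum would be no larger than
        \<open>?g S\<close>, of dimension 2l + 1, instead of 2(l + j + 1).\<close>
      have "?h \<noteq> \<zero>"
      proof
        assume "?h = \<zero>"
        then have "?h <# S \<subseteq> {\<zero>}" using Sc by (auto simp: l_coset_mem_iff subset_iff)
        then have "dim F (?h <# S) \<le> 0"
          using dim_mono[OF F hS subalgebra_triv[OF F]] dim_zero[OF F] by simp
        then show False using sum by simp
      qed
      then have h0: "?h \<in> carrier R - {\<zero>}" using hc by simp
      note ih = inv_props[OF h0]
      let ?a = "inv ?h \<otimes> ?g"
      have a0: "?a \<in> carrier R - {\<zero>}" using g0 ih(1,2) by (auto simp: integral_iff)
      have "?h \<otimes> ?a = ?g" using hc gc ih by (simp add: m_assoc[symmetric])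
      then have "?h <# (?a <# S) = ?g <# S" using l_coset_mult[OF hc _ Sc] a0 by simp
      then have "(?h <# S) \<inter> (?g <# S) = ?h <# (S \<inter> (?a <# S))"
        using l_coset_Int[OF h0 Sc l_coset_in_carrier[OF _ Sc]] a0 by simp
      then have "dim F (S \<inter> (?a <# S)) = dim F ((?h <# S) \<inter> (?g <# S))"
        using dim_l_coset[OF F h0 le_infI1[OF Sc], of "?a <# S"] by simp
      also have "\<dots> = i" using sum dim_l_coset_subalgebra[OF F S h0] dS j by simp
      finally show ?thesis using a0 unfolding attains_def by blast
    qed
  qed
qed

section \<open>Codes\<close>

lemma subfield_pow_card:
  assumes "subfield F R" "x \<in> F - {\<zero>}"
  shows "x [^] (card F - 1) = \<one>"
proof -
  let ?G = "(Multiplicative_Group.mult_of R) \<lparr> carrier := F - {\<zero>} \<rparr>"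
  interpret M: group "Multiplicative_Group.mult_of R" by (rule field_mult_group)
  have sg: "subgroup (F - {\<zero>}) (Multiplicative_Group.mult_of R)" by (rule subgroup_mult_of[OF assms(1)])
  interpret G: group ?G by (rule M.subgroup_imp_group[OF sg])
  have "x [^]\<^bsub>?G\<^esub> order ?G = \<one>\<^bsub>?G\<^esub>"
    using G.pow_order_eq_1 assms(2) by simp
  moreover have "order ?G = card F - 1"
    using subringE(2)[OF subfieldE(1)[OF assms(1)]] finite_subset_carrier[OF subfieldE(3)[OF assms(1)]]
    by (simp add: order_def)
  moreover have "x [^]\<^bsub>?G\<^esub> m = x [^] m" for m :: nat
    by (simp add: nat_pow_def Multiplicative_Group.mult_of_def)
  ultimately show ?thesis by simp
qed

text \<open>With q = \<open>card F\<close>, the nonzero elements of \<open>H\<close> are all the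
  roots of X^(q^2 - 1) - 1, and q - 1 divides the exponent. Form (2) specifies the larger field by
  its cardinality, so its inclusion of \<open>K\<close> is derived here.\<close>

lemma subfield_card_square_subset:
  assumes "subfield F R" "subfield H R" "card H = (card F)\<^sup>2"
  shows "F \<subseteq> H"
proof -
  let ?N = "card H - 1"
  have q: "card F \<ge> 2" "card H \<ge> 2" using card_subfield_ge_2 assms by auto
  have Hc: "H \<subseteq> carrier R" and Fc: "F \<subseteq> carrier R" using assms subfieldE(3) by auto
  have z: "\<zero> \<in> H" using subringE(2)[OF subfieldE(1)[OF assms(2)]] .
  let ?R = "{x \<in> carrier R. x [^] ?N = \<one>}"
  have "H - {\<zero>} \<subseteq> ?R" using subfield_pow_card[OF assms(2)] Hc by blast
  moreover have "card ?R \<le> card (H - {\<zero>})"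
    using num_roots_le_deg[OF finite_carrier, of ?N] q z finite_subset_carrier[OF Hc] by simp
  moreover have "finite ?R" using finite_subset_carrier by simp
  ultimately have R: "H - {\<zero>} = ?R" using card_seteq by blast
  have N: "?N = (card F - 1) * (card F + 1)"
    using q unfolding assms(3) by (cases "card F") (simp_all add: power2_eq_square)
  have "x \<in> H" if x: "x \<in> F" for x
  proof (cases "x = \<zero>")
    case False
    have xc: "x \<in> carrier R" using x Fc by blast
    have "x [^] ?N = (x [^] (card F - 1)) [^] (card F + 1)"
      unfolding N nat_pow_pow[OF xc] ..
    also have "\<dots> = \<one>" using subfield_pow_card[OF assms(1)] x False nat_pow_one by simp
    finally show ?thesis using R xc by blast
  qed (use z in simp)
  then show ?thesis by blast
qed

lemma grassmannian_iff:
  assumes "subfield K R"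
  shows "S \<in> grassmannian R K k \<longleftrightarrow> subalgebra K S R \<and> dim K S = k"
  unfolding grassmannian_def using dim_eqI[OF assms] dimension_dim[OF assms] by auto

text \<open>Distance 2i means an intersection of dimension k - i, so the weights i = 1, ..., k match
  the dimensions k - 1, ..., 0.\<close>

lemma FWS_code_iff:
  assumes "subfield K R" "S \<in> grassmannian R K k"
  shows "FWS_code R K k (Orb R S) \<longleftrightarrow> (\<forall>i<k. attains K S i)"
proof -
  have S: "subalgebra K S R" "dim K S = k" using assms grassmannian_iff by auto
  have "finite (Orb R S)" unfolding Orb_def using finite_carrier by simp
  then have "weight_count R K k (Orb R S) i > 0 \<longleftrightarrow>
      (\<exists>V\<in>Orb R S. 2 * k - 2 * dim K (S \<inter> V) = 2 * i)" for i
    unfolding weight_count_eq[OF assms refl] subspace_dist_def by (auto simp: card_gt_0_iff)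
  also have "\<dots> i \<longleftrightarrow> (\<exists>a\<in>carrier R - {\<zero>}. 2 * k - 2 * dim K (S \<inter> (a <# S)) = 2 * i)" for i
    unfolding Orb_def by blast
  also have "\<dots> i \<longleftrightarrow> attains K S (k - i)" if "i \<in> {1..k}" for i
  proof -
    have "dim K (S \<inter> (a <# S)) \<le> k" if "a \<in> carrier R - {\<zero>}" for a
      using dim_mono[OF assms(1) subalgebra_inter[OF S(1) subalgebra_l_coset[OF assms(1) S(1)]] S(1) Int_lower1]
        that S(2) by simp
    then have "2 * k - 2 * dim K (S \<inter> (a <# S)) = 2 * i \<longleftrightarrow> dim K (S \<inter> (a <# S)) = k - i"
      if "a \<in> carrier R - {\<zero>}" for a
      using that \<open>i \<in> {1..k}\<close> by fastforce
    then show ?thesis unfolding attains_def by blast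
  qed
  finally have "FWS_code R K k (Orb R S) \<longleftrightarrow> (\<forall>i\<in>{1..k}. attains K S (k - i))"
    unfolding FWS_code_def by blast
  also have "\<dots> \<longleftrightarrow> (\<forall>i<k. attains K S i)"
  proof
    assume *: "\<forall>i\<in>{1..k}. attains K S (k - i)"
    show "\<forall>i<k. attains K S i"
    proof (intro allI impI)
      fix i assume "i < k"
      then show "attains K S i" using bspec[OF *, of "k - i"] by simp
    qed
  qed simp
  finally show ?thesis .
qed

lemma Orb_l_coset:
  assumes "S \<subseteq> carrier R" "c \<in> carrier R - {\<zero>}"
  shows "Orb R (c <# S) = Orb R S"
proof -
  have sub: "Orb R (b <# A) \<subseteq> Orb R A" if "A \<subseteq> carrier R" "b \<in> carrier R - {\<zero>}" for A b
  proof
    fix V assume "V \<in> Orb R (b <# A)"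
    then obtain a where "a \<in> carrier R - {\<zero>}" "V = a <# (b <# A)" unfolding Orb_def by blast
    then have "V = (a \<otimes> b) <# A" "a \<otimes> b \<in> carrier R - {\<zero>}"
      using that l_coset_mult by (auto simp: integral_iff)
    then show "V \<in> Orb R A" unfolding Orb_def by blast
  qed
  show ?thesis
    using sub[OF assms] sub[OF l_coset_in_carrier[OF _ assms(1)] inv_nonzero[OF assms(2)], of c]
      l_coset_inv_cancel(1)[OF assms(2,1)] assms(2) by auto
qed

lemma grassmannian_l_coset_cancel:
  assumes "subfield K R" "c \<in> carrier R - {\<zero>}" "S \<subseteq> carrier R" "c <# S \<in> grassmannian R K k"
  shows "S \<in> grassmannian R K k"
proof -
  have c: "inv c \<in> carrier R - {\<zero>}" "inv c <# (c <# S) = S"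
    using inv_nonzero[OF assms(2)] l_coset_inv_cancel(1)[OF assms(2,3)] by auto
  then show ?thesis
    using assms(4) subalgebra_l_coset[OF assms(1), of "c <# S" "inv c"] dim_l_coset_subalgebra[OF assms(1) _ c(1), of "c <# S"]
    unfolding grassmannian_iff[OF assms(1)] by auto
qed

end

section \<open>The characterization in terms of \<open>q\<close>, \<open>n\<close> and
  \<open>k\<close>\<close>

theorem theorem1p2:
  fixes L :: "('a, 'b) ring_scheme"
    and K :: "'a set" and q n k :: nat and C :: "'a set set"
  assumes "primepow q"
    and "field L" and "card (carrier L) = q ^ n"
    and "subfield K L" and "card K = q"
    and "1 \<le> k" and "k \<le> n"
    and "one_orbit_code L K k C"
  shows "FWS_code L K k C \<longleftrightarrow>
    (\<exists>S \<in> grassmannian L K k. C = Orb L S \<and>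
      ((\<exists>x \<in> carrier L - K.
          S = ring.Span L K (powers_below L x k) \<and>
          (adjoin_degree L K x < n \<longrightarrow> real k \<le> (real (adjoin_degree L K x) + 1) / 2) \<and>
          (adjoin_degree L K x = n \<longrightarrow> real k \<le> real n / 2))
       \<or>
       (even n \<and>
        (\<exists>F l. subfield F L \<and> card F = q\<^sup>2 \<and> k = 2 * l + 1 \<and>
          (\<exists>x \<in> carrier L - F.
            S = ring.Span L F (powers_below L x l) <+>\<^bsub>L\<^esub> ((x [^]\<^bsub>L\<^esub> l) <#\<^bsub>L\<^esub> K) \<and>
            ring.Span L F (powers_below L x l) \<inter> ((x [^]\<^bsub>L\<^esub> l) <#\<^bsub>L\<^esub> K) = {\<zero>\<^bsub>L\<^esub>} \<and>
            real l < real (adjoin_degree L F x) / 2)))))"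
    (is "_ \<longleftrightarrow> ?rhs")
proof -
  have q2: "q \<ge> 2" using primepow_gt_Suc_0[OF assms(1)] by simp
  interpret field L by (rule assms(2))
  interpret fin_field L
    using assms(3) q2 by unfold_locales (auto intro: card_ge_0_finite)
  note K = assms(4)
  have qinj: "a = b" if "q ^ a = q ^ b" for a b :: nat using that q2 by simp
  have carr: "subalgebra H (carrier L) L" if "subfield H L" for H
    using carrier_is_subalgebra[OF subfieldE(3)[OF that]] .
  have n: "dim K (carrier L) = n"
    using card_eq_dim[OF K carr[OF K]] assms(3,5) qinj by simp
  note span = pspan_def[symmetric]
  show ?thesis
  proof
    assume FWS: "FWS_code L K k C"
    obtain S where S: "S \<in> grassmannian L K k" "C = Orb L S"
      using assms(8) unfolding one_orbit_code_def by blast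
    have Sk: "subalgebra K S L" "dim K S = k" using S grassmannian_iff[OF K] by auto
    have att: "attains K S i" if "i < dim K S" for i
      using FWS that Sk unfolding S(2) FWS_code_iff[OF K S(1)] by simp
    have k: "1 \<le> dim K S" using Sk assms(6) by simp
    show ?rhs
    proof (rule attains_all_imp_form[OF K Sk(1) k att])
      fix c x
      assume chain: "c \<in> carrier L - {\<zero>\<^bsub>L\<^esub>}" "x \<in> carrier L - K" "S = c <#\<^bsub>L\<^esub> pspan K x (dim K S)"
        "2 * dim K S \<le> adjoin_degree L K x + 1" "2 * dim K S \<le> dim K (carrier L)"
      have xc: "x \<in> carrier L" using chain by simp
      note Pc = subalgebra_in_carrier[OF subalgebra_pspan[OF K xc]]
      have "C = Orb L (pspan K x k)" using S(2) chain(3) Orb_l_coset[OF Pc chain(1)] Sk by simp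
      moreover have "pspan K x k \<in> grassmannian L K k"
        using grassmannian_l_coset_cancel[OF K chain(1) Pc] S(1) chain(3) Sk by simp
      moreover have "adjoin_degree L K x < n \<longrightarrow> real k \<le> (real (adjoin_degree L K x) + 1) / 2"
        using of_nat_mono[OF chain(4), where ?'a = real] Sk(2) by simp
      moreover have "adjoin_degree L K x = n \<longrightarrow> real k \<le> real n / 2"
        using chain(5) Sk(2) n by (intro impI) linarith
      ultimately show ?rhs using chain(2) unfolding span by blast
    next
      fix H c w t
      assume quadratic: "subfield H L" "K \<subseteq> H" "dim K H = 2" "c \<in> carrier L - {\<zero>\<^bsub>L\<^esub>}"
        "w \<in> carrier L - H" "dim K S = 2 * t + 1"
        "S = c <#\<^bsub>L\<^esub> (pspan H w t <+>\<^bsub>L\<^esub> (w [^]\<^bsub>L\<^esub> t <#\<^bsub>L\<^esub> K))"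
        "pspan H w t \<inter> (w [^]\<^bsub>L\<^esub> t <#\<^bsub>L\<^esub> K) = {\<zero>\<^bsub>L\<^esub>}" "2 * t < adjoin_degree L H w"
      have wc: "w \<in> carrier L" using quadratic by simp
      have "subalgebra K (pspan H w t <+>\<^bsub>L\<^esub> (w [^]\<^bsub>L\<^esub> t <#\<^bsub>L\<^esub> K)) L"
        using subalgebra_set_add[OF K subalgebra_restrict[OF subalgebra_pspan[OF quadratic(1) wc] quadratic(2)]
            subalgebra_l_coset[OF K subfield_subalgebra[OF K subset_refl K]]] wc by simp
      note Pc = subalgebra_in_carrier[OF this]
      have "C = Orb L (pspan H w t <+>\<^bsub>L\<^esub> (w [^]\<^bsub>L\<^esub> t <#\<^bsub>L\<^esub> K))"
        using S(2) quadratic(7) Orb_l_coset[OF Pc quadratic(4)] by simp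
      moreover have "pspan H w t <+>\<^bsub>L\<^esub> (w [^]\<^bsub>L\<^esub> t <#\<^bsub>L\<^esub> K) \<in> grassmannian L K k"
        using grassmannian_l_coset_cancel[OF K quadratic(4) Pc] S(1) quadratic(7) by simp
      moreover have "even n"
        using dim_subfield_dvd[OF K quadratic(1,2) carr[OF quadratic(1)]] quadratic(3) n by simp
      moreover have "card H = q\<^sup>2"
        using card_eq_dim[OF K subfield_subalgebra[OF K quadratic(2,1)]] quadratic(3) assms(5) by simp
      moreover have "k = 2 * t + 1" using quadratic(6) Sk by simp
      moreover have "real t < real (adjoin_degree L H w) / 2" using quadratic(9) by linarith
      ultimately show ?rhs using quadratic(1,5,8) unfolding span by blast
    qed
  next
    assume ?rhs
    then obtain S where S: "S \<in> grassmannian L K k" "C = Orb L S"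
      and form: "(\<exists>x \<in> carrier L - K.
          S = pspan K x k \<and>
          (adjoin_degree L K x < n \<longrightarrow> real k \<le> (real (adjoin_degree L K x) + 1) / 2) \<and>
          (adjoin_degree L K x = n \<longrightarrow> real k \<le> real n / 2))
       \<or> (\<exists>F l. subfield F L \<and> card F = q\<^sup>2 \<and> k = 2 * l + 1 \<and>
          (\<exists>x \<in> carrier L - F.
            S = pspan F x l <+>\<^bsub>L\<^esub> ((x [^]\<^bsub>L\<^esub> l) <#\<^bsub>L\<^esub> K) \<and>
            real l < real (adjoin_degree L F x) / 2))"
      unfolding span by blast
    have Sk: "subalgebra K S L" "dim K S = k" using S grassmannian_iff[OF K] by auto
    have "attains K S i" if i: "i < k" for i
      using form
    proof (elim disjE bexE exE conjE)
      fix x assume x: "x \<in> carrier L - K" "S = pspan K x k"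
        "adjoin_degree L K x < n \<longrightarrow> real k \<le> (real (adjoin_degree L K x) + 1) / 2"
        "adjoin_degree L K x = n \<longrightarrow> real k \<le> real n / 2"
      have "adjoin_degree L K x \<le> n"
        using dim_mono[OF K adjoin_props(4)[OF K] carr[OF K]] x(1) n subfieldE(3)[OF adjoin_props(1)[OF K]]
        unfolding adjoin_degree_def by simp
      then have "adjoin_degree L K x < n \<or> adjoin_degree L K x = n" by linarith
      \<comment> \<open>Cleared of the division by two, the conditional bounds become the
        disjunction of \<open>chain_attains\<close>: the weaker bound comes with \<open>K(x)\<close>
        being a proper subfield.\<close>
      then have "2 * k \<le> adjoin_degree L K x \<or> 2 * k \<le> adjoin_degree L K x + 1 \<and> adjoin_degree L K x < dim K (carrier L)"
      proof
        assume lt: "adjoin_degree L K x < n"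
        then have "real k \<le> (real (adjoin_degree L K x) + 1) / 2" using x(3) by blast
        then have "real (2 * k) \<le> real (adjoin_degree L K x + 1)" by simp
        then have "2 * k \<le> adjoin_degree L K x + 1" by (simp only: of_nat_le_iff)
        then show ?thesis using lt n by simp
      next
        assume eq: "adjoin_degree L K x = n"
        then have "2 * k \<le> n" using x(4) by linarith
        then show ?thesis using eq by simp
      qed
      then show ?thesis using chain_attains[OF K x(1) _ assms(6) _ i] Sk x(2) by simp
    next
      fix F l x assume F: "subfield F L" "card F = q\<^sup>2" "k = 2 * l + 1" "x \<in> carrier L - F"
        "S = pspan F x l <+>\<^bsub>L\<^esub> ((x [^]\<^bsub>L\<^esub> l) <#\<^bsub>L\<^esub> K)" "real l < real (adjoin_degree L F x) / 2"
      have KF: "K \<subseteq> F" using subfield_card_square_subset[OF K F(1)] F(2) assms(5) by simp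
      have "dim K F = 2"
        using card_eq_dim[OF K subfield_subalgebra[OF K KF F(1)]] F(2) assms(5) qinj[of 2] by simp
      then show ?thesis
        using quadratic_attains[OF K F(1) KF _ F(4), of l i] F(3,5,6) i by simp
    qed
    then show "FWS_code L K k C" unfolding S(2) FWS_code_iff[OF K S(1)] by blast
  qed
qed

end
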